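(* Let $N\geq1$ and $d\geq1$ be integers, let $f\colon\mathbb{R}^{d}\to\mathbb{R}$ be $L$-smooth and $\mu$-strongly convex with $q=\mu/L\in(0,1)$, let $\Upsilon_N$ and $a_0,\dots,a_N$ be the constants defined in the context, and let $x_\star=\operatorname{argmin} f$ and $f_\star=f(x_\star)$. Then, for any starting point $x_0\in\mathbb{R}^d$, the final iterate $x_N$ of the method ITEM-f (defined in the context) satisfies $$f(x_N)-f_\star\;\leq\;\frac{1}{\Upsilon_N^{2}}\bigl(f(x_0)-f_\star\bigr)\;\leq\;4(1-\sqrt q)^{2N}\bigl(f(x_0)-f_\star\bigr).$$
   Context: $f$ is $L$-smooth if it is differentiable with $L$-Lipschitz gradient, and $\mu$-strongly convex if $f-\frac{\mu}{2}\|\cdot\|^2$ is convex; here $0<\mu<L$. Construction of the constants. For integer $N\ge1$ and $0<q<1$ there exist a unique real $\Upsilon_N>1$, unique reals $1/\Upsilon_N=a_0<a_1<\cdots<a_N<a_{N+1}=\Upsilon_N$, and unique positive reals $b_0,\dots,b_{N+1}$ such that, with $C=(\Upsilon_N,0)$, $R_N=\sqrt{\Upsilon_N^2-1}$ and $P_k=(a_k,b_k)\in\mathbb{R}^2$, - $\|P_k-C\|^2=R_N^2$ for $1\le k\le N$; - $(P_k-C)\cdot(P_{k+1}-C)=R_N^2\bigl(1-\tfrac{q\,a_{k+1}}{\Upsilon_N}\bigr)$ for $0\le k\le N$; - $P_0=\bigl(\tfrac1{\Upsilon_N},\tfrac{\sqrt{1-q}\,R_N}{\Upsilon_N}\bigr)$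 and $P_{N+1}=(\Upsilon_N,\sqrt{1-q}\,R_N)$. Set $\phi_0=\sqrt{1-q}$, $\phi_N=\bigl((1-q)\Upsilon_N+a_N\bigr)/\sqrt{1-q}$, and $\phi_k=\sqrt{2\Upsilon_N a_k-q}$ for $1\le k\le N-1$. The method ITEM-f with iteration count $N$: with $x_k^{+}=x_k-\frac1L\nabla f(x_k)$ and the convention $x_{-1}^{+}=x_0$, for $k=0,1,\dots,N-1$, $$x_{k+1}=x_k^{+}+\frac{a_k\,\phi_{N-k-1}}{(1-q)\,a_{k+1}\,\phi_{N-k}}\,(x_k^{+}-x_{k-1}^{+})+\frac{\phi_{N-k-1}}{\phi_{N-k}}\,(x_k^{+}-x_k).$$ *)

theory Defs
  imports "HOL-Analysis.Analysis"
begin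

definition grad :: "('a::real_inner \<Rightarrow> real) \<Rightarrow> 'a \<Rightarrow> 'a" where
  "grad f x = (THE D. GDERIV f x :> D)"

definition L_smooth :: "real \<Rightarrow> ('a::real_inner \<Rightarrow> real) \<Rightarrow> bool" where
  "L_smooth L f \<longleftrightarrow> (\<forall>x. f differentiable (at x)) \<and> L-lipschitz_on UNIV (grad f)"

definition strongly_convex :: "real \<Rightarrow> ('a::real_inner \<Rightarrow> real) \<Rightarrow> bool" where
  "strongly_convex \<mu> f \<longleftrightarrow> convex_on UNIV (\<lambda>x. f x - \<mu> / 2 * (norm x)\<^sup>2)"

text \<open>The defining system of the constants; only the values of \<open>a\<close> and \<open>b\<close> at
  \<open>0, \<dots>, N + 1\<close> matter. The points of the plane are pairs, with the Euclidean
  inner product and norm of the product type.\<close>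

definition ITEM_f_constants ::
  "nat \<Rightarrow> real \<Rightarrow> real \<Rightarrow> (nat \<Rightarrow> real) \<Rightarrow> (nat \<Rightarrow> real) \<Rightarrow> bool" where
  "ITEM_f_constants N q \<Upsilon> a b \<longleftrightarrow>
    (let C = (\<Upsilon>, 0 :: real);
         R = sqrt (\<Upsilon>\<^sup>2 - 1);
         P = (\<lambda>k. (a k, b k))
     in \<Upsilon> > 1
      \<and> a 0 = 1 / \<Upsilon> \<and> (\<forall>k\<le>N. a k < a (k + 1)) \<and> a (N + 1) = \<Upsilon>
      \<and> (\<forall>k\<le>N + 1. 0 < b k)
      \<and> (\<forall>k\<in>{1..N}. (norm (P k - C))\<^sup>2 = R\<^sup>2)
      \<and> (\<forall>k\<le>N. (P k - C) \<bullet> (P (k + 1) - C) = R\<^sup>2 * (1 - q * a (k + 1) / \<Upsilon>))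
      \<and> P 0 = (1 / \<Upsilon>, sqrt (1 - q) * R / \<Upsilon>)
      \<and> P (N + 1) = (\<Upsilon>, sqrt (1 - q) * R))"

definition ITEM_f_phi :: "nat \<Rightarrow> real \<Rightarrow> real \<Rightarrow> (nat \<Rightarrow> real) \<Rightarrow> nat \<Rightarrow> real" where
  "ITEM_f_phi N q \<Upsilon> a k =
    (if k = 0 then sqrt (1 - q)
     else if k = N then ((1 - q) * \<Upsilon> + a N) / sqrt (1 - q)
     else sqrt (2 * \<Upsilon> * a k - q))"

definition grad_step :: "real \<Rightarrow> ('a::real_inner \<Rightarrow> real) \<Rightarrow> 'a \<Rightarrow> 'a" where
  "grad_step L f x = x - (1 / L) *\<^sub>R grad f x"

text \<open>The iterates of the method with iteration count \<open>N\<close>, started at \<open>x0\<close>. They are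
  meaningful up to index \<open>N\<close> only: beyond that the subtractions \<open>N - k\<close> and \<open>N - k - 1\<close>
  truncate. The convention for the gradient step at index \<open>-1\<close> is the case \<open>k = 0\<close>.\<close>

fun ITEM_f ::
  "nat \<Rightarrow> real \<Rightarrow> real \<Rightarrow> real \<Rightarrow> (nat \<Rightarrow> real) \<Rightarrow> ('a::real_inner \<Rightarrow> real) \<Rightarrow> 'a \<Rightarrow> nat \<Rightarrow> 'a" where
  "ITEM_f N L q \<Upsilon> a f x0 0 = x0"
| "ITEM_f N L q \<Upsilon> a f x0 (Suc k) =
    (let x = ITEM_f N L q \<Upsilon> a f x0 k;
         x_plus = grad_step L f x;
         prev_plus = (if k = 0 then x0 else grad_step L f (ITEM_f N L q \<Upsilon> a f x0 (k - 1)));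
         \<phi> = ITEM_f_phi N q \<Upsilon> a
     in x_plus
        + (a k * \<phi> (N - k - 1) / ((1 - q) * a (k + 1) * \<phi> (N - k))) *\<^sub>R (x_plus - prev_plus)
        + (\<phi> (N - k - 1) / \<phi> (N - k)) *\<^sub>R (x_plus - x))"

end

theory Submission
  imports Defs
begin

text \<open>Besides having a minimizer, the function enters only through an inequality between its values and
gradients at two points (\<open>interpolation\<close>): the convex function \<open>f - \<mu>/2 \<parallel>\<cdot>\<parallel>\<^sup>2\<close> has an \<open>(L - \<mu>)\<close>-Lipschitz gradient. After
division by \<open>L\<close> and moving the minimizer to the origin, subtracting a suitable quadratic from the
function value at iterate \<open>k\<close> leaves a reduced value \<open>\<psi>\<^sub>k\<close> for which the inequality becomes bilinear:
\<open>w\<^sub>j \<bullet> (v\<^sub>i - v\<^sub>j) \<le> (1 - q) (\<psi>\<^sub>i - \<psi>\<^sub>j)\<close>, where \<open>v\<^sub>k = x\<^sub>k - g\<^sub>k\<close> is the gradient step and \<open>w\<^sub>k = g\<^sub>k - q x\<^sub>k\<close>.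

Adding this inequality for the iterates \<open>k - 1\<close> and \<open>k\<close> with weight \<open>a\<^sub>k\<close>, and for the minimizer and
iterate \<open>k\<close> with weight \<open>a\<^sub>k\<^sub>+\<^sub>1 - a\<^sub>k\<close>, makes the coefficient of the reduced value grow from \<open>a\<^sub>0 = 1/\<Upsilon>\<close> to
\<open>a\<^sub>N\<^sub>+\<^sub>1 = \<Upsilon>\<close>, which accounts for the factor \<open>1/\<Upsilon>\<^sup>2\<close>. It remains to see that the inner products left over
have the right sign. In terms of a momentum \<open>e\<^sub>k\<close> with \<open>x\<^sub>k = v\<^sub>k\<^sub>-\<^sub>1 + \<phi>\<^sub>N\<^sub>-\<^sub>k e\<^sub>k / (1 - q)\<close>, they are the increments of
\<open>q (a\<^sub>k - 1/(2 \<Upsilon>)) \<parallel>v\<^sub>k\<^sub>-\<^sub>1\<parallel>\<^sup>2 + \<surd>q b\<^sub>k (v\<^sub>k\<^sub>-\<^sub>1 \<bullet> e\<^sub>k) + \<Upsilon>/2 \<parallel>e\<^sub>k\<parallel>\<^sup>2\<close>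
(\<open>potential_Suc\<close>), and after the last step only the square \<open>\<Upsilon>/2 \<parallel>v\<^sub>N - (a\<^sub>N/\<Upsilon>) v\<^sub>N\<^sub>-\<^sub>1\<parallel>\<^sup>2\<close> is left (\<open>potential_last\<close>).

Why the increments fit is plane geometry. The cosine of the angle between consecutive points on the
circle is prescribed; computing with its sine gives \<open>\<surd>q b\<^sub>k\<^sub>+\<^sub>1 = a\<^sub>k\<^sub>+\<^sub>1 p - \<phi>\<^sub>k\<close>, \<open>\<surd>q b\<^sub>k = \<phi>\<^sub>k - a\<^sub>k p\<close> and
\<open>\<Upsilon> (a\<^sub>k + (1 - q) a\<^sub>k\<^sub>+\<^sub>1) = a\<^sub>k\<^sub>+\<^sub>1 p \<phi>\<^sub>k\<close> with \<open>p\<^sup>2 = 2 \<Upsilon> / a\<^sub>k\<^sub>+\<^sub>1 - q\<close> (\<open>arc_relations\<close>). The configuration is invariant under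
\<open>(a, b) \<mapsto> (1/a, b/a)\<close> with reversal of the order (\<open>reciprocal\<close>), so that \<open>p = \<phi>\<^sub>N\<^sub>-\<^sub>k\<close>.

For the explicit rate, the tangent of half the angle at the centre, measured from the ray towards the
origin, shrinks by the factor \<open>1 - \<surd>q\<close> at least from each point to the one before it
(\<open>half_angle_step\<close>). Its values at the first and the last point on the circle are explicit, and
comparing them bounds \<open>\<Upsilon>\<close> from below.\<close>

section \<open>Smooth strongly convex functions\<close>

text \<open>In a Euclidean space every derivative is the inner product with a vector, so that
differentiability alone makes the description in \<^const>\<open>grad\<close> denote a gradient.\<close>

lemma GDERIV_grad:
  fixes f :: "'a::euclidean_space \<Rightarrow> real"
  assumes "f differentiable (at x)"
  shows "GDERIV f x :> grad f x"
proof -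
  obtain f' where f': "(f has_derivative f') (at x)"
    using assms by (auto simp: differentiable_def)
  define D where "D = (\<Sum>i\<in>Basis. f' i *\<^sub>R i)"
  interpret f': bounded_linear f' using f' by (rule has_derivative_bounded_linear)
  have "f' h = h \<bullet> D" for h
  proof -
    have "f' h = f' (\<Sum>i\<in>Basis. (h \<bullet> i) *\<^sub>R i)" by (simp add: euclidean_representation)
    also have "\<dots> = (\<Sum>i\<in>Basis. (h \<bullet> i) * f' i)" by (simp add: f'.sum f'.scaleR)
    also have "\<dots> = h \<bullet> D" by (simp add: D_def inner_sum_right mult.commute)
    finally show ?thesis .
  qed
  then have "f' = (\<lambda>h. h \<bullet> D)" by (rule ext)
  then have D: "GDERIV f x :> D" using f' by (simp add: gderiv_def)
  have "E = D" if "GDERIV f x :> E" for E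
  proof -
    have "(\<lambda>h. h \<bullet> E) = (\<lambda>h. h \<bullet> D)"
      using that D unfolding gderiv_def by (rule has_derivative_unique)
    then have "(E - D) \<bullet> E = (E - D) \<bullet> D" by (rule fun_cong)
    then have "(E - D) \<bullet> (E - D) = 0" by (simp add: inner_diff_right)
    then show ?thesis by simp
  qed
  then have "grad f x = D" unfolding grad_def using D by (rule the_equality[rotated])
  then show ?thesis using D by simp
qed

lemma GDERIV_along_line:
  fixes f :: "'a::real_inner \<Rightarrow> real"
  assumes "GDERIV f (x + t *\<^sub>R d) :> D"
  shows "((\<lambda>t. f (x + t *\<^sub>R d)) has_real_derivative (d \<bullet> D)) (at t within S)"
proof -
  have "((\<lambda>t. x + t *\<^sub>R d) has_derivative (\<lambda>h. h *\<^sub>R d)) (at t within S)"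
    by (auto intro!: derivative_eq_intros)
  then have "((\<lambda>t. f (x + t *\<^sub>R d)) has_derivative (\<lambda>h. (h *\<^sub>R d) \<bullet> D)) (at t within S)"
    using assms unfolding gderiv_def by (rule has_derivative_compose)
  then show ?thesis by (simp add: has_field_derivative_def mult_commute_abs)
qed

text \<open>Along the segment the function minus its first-order model and minus the quadratic has the
derivative \<open>d \<bullet> (G (x + t d) - G x) - L t \<parallel>d\<parallel>\<^sup>2\<close>, which is nonpositive by Cauchy-Schwarz and the
Lipschitz bound.\<close>

lemma lipschitz_gradient_upper_bound:
  fixes f :: "'a::real_inner \<Rightarrow> real"
  assumes G: "\<And>x. GDERIV f x :> G x" and lip: "L-lipschitz_on UNIV G"
  shows "f y \<le> f x + G x \<bullet> (y - x) + L / 2 * (norm (y - x))\<^sup>2"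
proof -
  define d where "d = y - x"
  define u where "u t = f (x + t *\<^sub>R d) - t * (d \<bullet> G x) - L / 2 * t\<^sup>2 * (norm d)\<^sup>2" for t
  have "u 1 \<le> u 0"
  proof (rule DERIV_nonpos_imp_nonincreasing[of 0 1 u])
    fix t :: real assume t: "0 \<le> t" "t \<le> 1"
    have "(u has_real_derivative (d \<bullet> G (x + t *\<^sub>R d) - d \<bullet> G x - L * t * (norm d)\<^sup>2)) (at t)"
      unfolding u_def using GDERIV_along_line[of f x t d, OF G]
      by (auto intro!: derivative_eq_intros)
    moreover have "d \<bullet> G (x + t *\<^sub>R d) - d \<bullet> G x - L * t * (norm d)\<^sup>2 \<le> 0"
    proof -
      have "d \<bullet> (G (x + t *\<^sub>R d) - G x) \<le> norm d * norm (G (x + t *\<^sub>R d) - G x)"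
        by (rule norm_cauchy_schwarz)
      also have "\<dots> \<le> norm d * (L * norm (t *\<^sub>R d))"
        using lipschitz_onD[OF lip, of "x + t *\<^sub>R d" x]
        by (intro mult_left_mono) (auto simp: dist_norm)
      also have "\<dots> = L * t * (norm d)\<^sup>2" using t by (simp add: power2_eq_square)
      finally show ?thesis by (simp add: inner_diff_right)
    qed
    ultimately show "\<exists>D. (u has_real_derivative D) (at t) \<and> D \<le> 0" by blast
  qed simp
  then show ?thesis by (simp add: u_def d_def inner_commute)
qed

lemma convex_on_gradient_lower_bound:
  fixes h :: "'a::real_inner \<Rightarrow> real"
  assumes conv: "convex_on UNIV h" and D: "GDERIV h x :> D"
  shows "h x + D \<bullet> (y - x) \<le> h y"
proof -
  define d where "d = y - x"
  have "convex_on UNIV (\<lambda>t. h (x + t *\<^sub>R d))"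
  proof (rule convex_onI)
    fix t s r :: real assume t: "0 < t" "t < 1"
    have "x + ((1 - t) *\<^sub>R s + t *\<^sub>R r) *\<^sub>R d = (1 - t) *\<^sub>R (x + s *\<^sub>R d) + t *\<^sub>R (x + r *\<^sub>R d)"
      by (simp add: algebra_simps)
    then show "h (x + ((1 - t) *\<^sub>R s + t *\<^sub>R r) *\<^sub>R d)
        \<le> (1 - t) * h (x + s *\<^sub>R d) + t * h (x + r *\<^sub>R d)"
      using convex_onD[OF conv, of t "x + s *\<^sub>R d" "x + r *\<^sub>R d"] t by simp
  qed simp
  moreover have "((\<lambda>t. h (x + t *\<^sub>R d)) has_real_derivative (d \<bullet> D)) (at 0 within UNIV)"
    by (rule GDERIV_along_line) (simp add: D)
  ultimately have "h (x + 1 *\<^sub>R d) - h (x + 0 *\<^sub>R d) \<ge> (d \<bullet> D) * (1 - 0)"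
    using convex_on_imp_above_tangent[OF _ connected_UNIV, of "\<lambda>t. h (x + t *\<^sub>R d)" 0 1 "d \<bullet> D"]
    unfolding interior_UNIV by blast
  then have "h (x + d) - h x \<ge> d \<bullet> D" by simp
  moreover have "x + d = y" by (simp add: d_def)
  moreover have "d \<bullet> D = D \<bullet> (y - x)" unfolding d_def by (rule inner_commute)
  ultimately show ?thesis by simp
qed

locale smooth_strongly_convex =
  fixes L \<mu> :: real and f :: "'a::euclidean_space \<Rightarrow> real"
  assumes \<mu>: "0 < \<mu>" "\<mu> < L" and smooth: "L_smooth L f" and strong: "strongly_convex \<mu> f"
begin

lemma GDERIV_f: "GDERIV f x :> grad f x"
proof (rule GDERIV_grad)
  show "f differentiable (at x)" using smooth unfolding L_smooth_def by blast
qed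

lemma upper_bound: "f y \<le> f x + grad f x \<bullet> (y - x) + L / 2 * (norm (y - x))\<^sup>2"
proof (rule lipschitz_gradient_upper_bound[where G = "grad f"])
  show "GDERIV f x :> grad f x" for x by (rule GDERIV_f)
  show "L-lipschitz_on UNIV (grad f)" using smooth unfolding L_smooth_def by blast
qed

lemma lower_bound: "f x + grad f x \<bullet> (y - x) + \<mu> / 2 * (norm (y - x))\<^sup>2 \<le> f y"
proof -
  have "GDERIV (\<lambda>x. f x - \<mu> / 2 * (norm x)\<^sup>2) x :> (grad f x - \<mu> *\<^sub>R x)"
  proof -
    have "((\<lambda>x. x \<bullet> x) has_derivative (\<lambda>h. x \<bullet> h + h \<bullet> x)) (at x)"
      by (rule has_derivative_inner[OF has_derivative_ident has_derivative_ident])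
    then have "((\<lambda>x. f x - \<mu> / 2 * (x \<bullet> x)) has_derivative
        (\<lambda>h. h \<bullet> grad f x - \<mu> / 2 * (x \<bullet> h + h \<bullet> x))) (at x)"
      using GDERIV_f[of x] unfolding gderiv_def
      by (intro has_derivative_diff has_derivative_mult_right)
    moreover have "(\<lambda>h. h \<bullet> grad f x - \<mu> / 2 * (x \<bullet> h + h \<bullet> x)) = (\<lambda>h. h \<bullet> (grad f x - \<mu> *\<^sub>R x))"
      by (rule ext) (simp add: inner_diff_right inner_commute)
    ultimately show ?thesis by (simp add: gderiv_def power2_norm_eq_inner)
  qed
  then have "f x - \<mu> / 2 * (norm x)\<^sup>2 + (grad f x - \<mu> *\<^sub>R x) \<bullet> (y - x) \<le> f y - \<mu> / 2 * (norm y)\<^sup>2"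
    by (rule convex_on_gradient_lower_bound[OF strong[unfolded strongly_convex_def]])
  then show ?thesis
    unfolding power2_norm_eq_inner
    by (simp add: inner_diff_left inner_diff_right inner_commute algebra_simps)
qed

text \<open>The function minus \<open>\<mu>/2 \<parallel>\<cdot>\<parallel>\<^sup>2\<close> is convex with upper quadratic models of curvature \<open>L - \<mu>\<close>. Its tangent
at \<open>y\<close> therefore lies below its upper model at \<open>x\<close> everywhere; comparing the two at the minimizer
\<open>z\<close> of their difference gives the strongest consequence. Besides the existence of a minimizer it is all that the
convergence proof uses about the function.\<close>

lemma interpolation:
  "f y + grad f y \<bullet> (x - y) + \<mu> / 2 * (norm (x - y))\<^sup>2
    + (norm (grad f x - grad f y - \<mu> *\<^sub>R (x - y)))\<^sup>2 / (2 * (L - \<mu>)) \<le> f x"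
proof -
  define w where "w = grad f x - grad f y - \<mu> *\<^sub>R (x - y)"
  define d where "d = x - y"
  define s where "s = 1 / (L - \<mu>)"
  define z where "z = x - s *\<^sub>R w"
  have s: "0 < s" "(L - \<mu>) * s = 1" using \<mu> by (auto simp: s_def)
  have gx: "grad f x = grad f y + \<mu> *\<^sub>R d + w" by (simp add: w_def d_def)
  have zx: "z - x = - s *\<^sub>R w" and zy: "z - y = d - s *\<^sub>R w" by (simp_all add: z_def d_def)
  have "f y + grad f y \<bullet> (z - y) + \<mu> / 2 * (norm (z - y))\<^sup>2
      \<le> f x + grad f x \<bullet> (z - x) + L / 2 * (norm (z - x))\<^sup>2"
    using lower_bound[of y z] upper_bound[of z x] by (rule order_trans)
  then have "f y + (grad f y \<bullet> d - s * (grad f y \<bullet> w))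
        + \<mu> / 2 * (d \<bullet> d - 2 * s * (d \<bullet> w) + s\<^sup>2 * (w \<bullet> w))
      \<le> f x - s * (grad f y \<bullet> w + \<mu> * (d \<bullet> w) + w \<bullet> w) + L / 2 * (s\<^sup>2 * (w \<bullet> w))"
    unfolding zx zy gx power2_norm_eq_inner
    by (simp add: inner_add_left inner_diff_left inner_diff_right inner_commute power2_eq_square algebra_simps)
  moreover have "L / 2 * (s\<^sup>2 * (w \<bullet> w)) = \<mu> / 2 * (s\<^sup>2 * (w \<bullet> w)) + s / 2 * (w \<bullet> w)"
    using s(2) by algebra
  ultimately have "f y + grad f y \<bullet> d + \<mu> / 2 * (d \<bullet> d) + s / 2 * (w \<bullet> w) \<le> f x"
    by (simp add: field_simps)
  moreover have "s / 2 * (w \<bullet> w) = (w \<bullet> w) / (2 * (L - \<mu>))"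
    by (simp add: s_def mult.commute[of _ "2::real"])
  ultimately show ?thesis
    unfolding w_def[symmetric] power2_norm_eq_inner by (simp only: d_def)
qed

text \<open>Dividing function and gradient by \<open>L\<close> turns a gradient step into the subtraction of the gradient,
and leaves \<open>q\<close> as the only parameter.\<close>

lemma interpolation_normalized:
  fixes x y :: 'a
  defines "q \<equiv> \<mu> / L" and "g \<equiv> (1 / L) *\<^sub>R grad f x" and "h \<equiv> (1 / L) *\<^sub>R grad f y"
  shows "f y / L + h \<bullet> (x - y) + q / 2 * (norm (x - y))\<^sup>2
    + (norm (g - h - q *\<^sub>R (x - y)))\<^sup>2 / (2 * (1 - q)) \<le> f x / L"
proof -
  define z where "z = g - h - q *\<^sub>R (x - y)"
  have L: "0 < L" using \<mu> by simp
  have \<mu>q: "\<mu> = L * q" "L - \<mu> = L * (1 - q)" using L by (simp_all add: q_def right_diff_distrib)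
  have gh: "grad f x = L *\<^sub>R g" "grad f y = L *\<^sub>R h" using L by (simp_all add: g_def h_def)
  have Lz: "grad f x - grad f y - \<mu> *\<^sub>R (x - y) = L *\<^sub>R z"
    unfolding gh \<mu>q(1) z_def by (simp add: scaleR_diff_right)
  have "f y + (L *\<^sub>R h) \<bullet> (x - y) + L * q / 2 * (norm (x - y))\<^sup>2
      + (norm (L *\<^sub>R z))\<^sup>2 / (2 * (L * (1 - q))) \<le> f x"
    using interpolation[of y x] unfolding Lz unfolding gh(2) \<mu>q(2) unfolding \<mu>q(1) .
  moreover have "(norm (L *\<^sub>R z))\<^sup>2 / (2 * (L * (1 - q))) = L * ((norm z)\<^sup>2 / (2 * (1 - q)))"
    using L by (simp add: power_mult_distrib power2_eq_square)
  ultimately have "f y + L * (h \<bullet> (x - y) + q / 2 * (norm (x - y))\<^sup>2 + (norm z)\<^sup>2 / (2 * (1 - q))) \<le> f x"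
    by (simp add: distrib_left)
  then have "h \<bullet> (x - y) + q / 2 * (norm (x - y))\<^sup>2 + (norm z)\<^sup>2 / (2 * (1 - q)) \<le> (f x - f y) / L"
    using L by (simp add: pos_le_divide_eq mult.commute)
  then show ?thesis unfolding z_def by (simp add: diff_divide_distrib)
qed

text \<open>Outside a large ball the quadratic lower bound at the origin is at least the value there, so
minimizing over the ball suffices. This is what makes \<^const>\<open>arg_min\<close> meaningful.\<close>

lemma minimizer: "\<exists>x. \<forall>y. f x \<le> f y"
proof -
  define r where "r = 2 * norm (grad f 0) / \<mu>"
  have r: "0 \<le> r" using \<mu> by (simp add: r_def)
  have "continuous_on UNIV f"
    by (rule differentiable_imp_continuous_on) (use smooth in \<open>auto simp: L_smooth_def differentiable_on_def\<close>)
  then have "continuous_on (cball 0 r) f" by (rule continuous_on_subset) simp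
  then obtain x where x: "x \<in> cball 0 r" "\<And>y. y \<in> cball 0 r \<Longrightarrow> f x \<le> f y"
    using continuous_attains_inf[of "cball 0 r" f] r by auto
  have "f x \<le> f y" for y
  proof (cases "y \<in> cball 0 r")
    case False
    then have "r \<le> norm y" by simp
    then have "norm (grad f 0) \<le> \<mu> / 2 * norm y" using \<mu> by (simp add: r_def field_simps)
    then have "norm (grad f 0) * norm y \<le> \<mu> / 2 * norm y * norm y" by (rule mult_right_mono) simp
    moreover have "- (grad f 0 \<bullet> y) \<le> norm (grad f 0) * norm y"
      using Cauchy_Schwarz_ineq2[of "grad f 0" y] by simp
    ultimately have "f 0 \<le> f y"
      using lower_bound[of 0 y] by (simp add: power2_eq_square)
    then show ?thesis using x(2)[of 0] r by simp
  qed (rule x(2))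
  then show ?thesis by blast
qed

lemma arg_min_le: "f (arg_min f (\<lambda>_. True)) \<le> f y"
proof -
  obtain x where "\<forall>y. f x \<le> f y" using minimizer by blast
  then have "is_arg_min f (\<lambda>_. True) x" by (auto simp: is_arg_min_linorder)
  then have "is_arg_min f (\<lambda>_. True) (arg_min f (\<lambda>_. True))"
    unfolding arg_min_def by (rule someI)
  then show ?thesis by (auto simp: is_arg_min_linorder)
qed

lemma grad_minimizer:
  assumes "\<And>y. f x \<le> f y"
  shows "grad f x = 0"
proof -
  have "(\<lambda>h. h \<bullet> grad f x) = (\<lambda>h. 0)"
    using GDERIV_f[of x] assms unfolding gderiv_def
    by (intro differential_zero_maxmin[of x UNIV f]) auto
  then have "grad f x \<bullet> grad f x = 0" by (rule fun_cong)
  then show ?thesis by simp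
qed

end

text \<open>Subtracting \<open>(q (1 - q) \<parallel>x\<parallel>\<^sup>2 + \<parallel>g - q x\<parallel>\<^sup>2) / (2 (1 - q))\<close> from the function value at \<open>x\<close> absorbs
every square in the interpolation inequality. What is left is bilinear, in the shifted gradient
\<open>h - q y\<close> and the difference of the gradient steps \<open>x - g\<close> and \<open>y - h\<close>.\<close>

lemma interpolation_potential_form:
  fixes x y g h :: "'v::real_inner"
  assumes q: "q < 1"
    and "G + h \<bullet> (x - y) + q / 2 * (norm (x - y))\<^sup>2 + (norm (g - h - q *\<^sub>R (x - y)))\<^sup>2 / (2 * (1 - q)) \<le> F"
  shows "(h - q *\<^sub>R y) \<bullet> (x - g - (y - h))
    \<le> (1 - q) * (F - (q * (1 - q) * (norm x)\<^sup>2 + (norm (g - q *\<^sub>R x))\<^sup>2) / (2 * (1 - q))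
      - (G - (q * (1 - q) * (norm y)\<^sup>2 + (norm (h - q *\<^sub>R y))\<^sup>2) / (2 * (1 - q))))"
proof -
  have half: "(1 - q) * (Z / (2 * (1 - q))) = Z / 2" for Z
    using q by (simp add: divide_simps)
  define Ex where "Ex = q * (1 - q) * (norm x)\<^sup>2 + (norm (g - q *\<^sub>R x))\<^sup>2"
  define Ey where "Ey = q * (1 - q) * (norm y)\<^sup>2 + (norm (h - q *\<^sub>R y))\<^sup>2"
  have "(h - q *\<^sub>R y) \<bullet> (x - g - (y - h)) + Ex / 2 - Ey / 2
      = (1 - q) * (h \<bullet> (x - y) + q / 2 * (norm (x - y))\<^sup>2) + (norm (g - h - q *\<^sub>R (x - y)))\<^sup>2 / 2"
    unfolding Ex_def Ey_def power2_norm_eq_inner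
    by (simp add: inner_diff_left inner_diff_right inner_add_left inner_add_right inner_commute field_simps)
  also have "\<dots> = (1 - q) * (h \<bullet> (x - y) + q / 2 * (norm (x - y))\<^sup>2
      + (norm (g - h - q *\<^sub>R (x - y)))\<^sup>2 / (2 * (1 - q)))"
    by (simp only: distrib_left half)
  also have "\<dots> \<le> (1 - q) * (F - G)" using assms by (intro mult_left_mono) auto
  also have "\<dots> = (1 - q) * (F - Ex / (2 * (1 - q)) - (G - Ey / (2 * (1 - q)))) + Ex / 2 - Ey / 2"
  proof -
    have "(1 - q) * (F - G) = (1 - q) * (F - e - (G - e')) + (1 - q) * e - (1 - q) * e'" for e e'
      by algebra
    from this[of "Ex / (2 * (1 - q))" "Ey / (2 * (1 - q))"] show ?thesis unfolding half .
  qed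
  finally show ?thesis unfolding Ex_def Ey_def by simp
qed

section \<open>Consecutive points on the circle\<close>

text \<open>On the upper half of a circle around the origin, moving to a larger abscissa \<open>-X\<close> means turning
clockwise. This fixes the sign of the sine of the angle between two points, which the
equations for the constants do not mention.\<close>

lemma arc_cross_pos:
  fixes X X' b b' R2 :: real
  assumes "X\<^sup>2 + b\<^sup>2 = R2" "X'\<^sup>2 + b'\<^sup>2 = R2" "X' < X" "0 < b" "0 < b'"
  shows "b * X' < b' * X"
proof (rule ccontr)
  assume "\<not> ?thesis"
  then have le: "b' * X \<le> b * X'" by simp
  have R2: "0 < R2" using assms(1,4) by (metis add_nonneg_pos zero_le_power2 zero_less_power)
  have id: "(b' * X)\<^sup>2 - (b * X')\<^sup>2 = R2 * (X\<^sup>2 - X'\<^sup>2)"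
  proof -
    have eq: "b\<^sup>2 = R2 - X\<^sup>2" "b'\<^sup>2 = R2 - X'\<^sup>2" using assms(1,2) by auto
    show ?thesis unfolding power_mult_distrib eq by algebra
  qed
  consider "0 \<le> X'" | "X \<le> 0" | "X' < 0" "0 < X" by linarith
  then show False
  proof cases
    case 1
    then have "X'\<^sup>2 < X\<^sup>2" using assms(3) by (simp add: power_strict_mono)
    then have "(b * X')\<^sup>2 < (b' * X)\<^sup>2" using id R2 by (smt (verit) mult_pos_pos)
    moreover have "(b' * X)\<^sup>2 \<le> (b * X')\<^sup>2" using le 1 assms by (intro power_mono) auto
    ultimately show False by simp
  next
    case 2
    then have "X\<^sup>2 < X'\<^sup>2" using power_strict_mono[of "- X" "- X'" 2] assms(3) by simp
    then have "(b' * X)\<^sup>2 < (b * X')\<^sup>2" using id R2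
      by (smt (verit) mult_pos_neg)
    moreover have "(b * X')\<^sup>2 \<le> (b' * X)\<^sup>2"
      using power_mono[of "- (b * X')" "- (b' * X)" 2] le 2 assms by (simp add: mult_nonneg_nonpos)
    ultimately show False by simp
  next
    case 3
    then show False using le assms(4,5) by (smt (verit) mult_pos_neg mult_pos_pos)
  qed
qed

text \<open>Consecutive points of the circle, seen from its centre, enclose an angle whose cosine is prescribed;
the square root \<open>p\<close> is its sine up to normalization. Multiplying the sine by the two heights and
using the cosine expresses the heights rationally in \<open>a\<close>, \<open>a'\<close>, \<open>p\<close>. Eliminating them gives a quadratic
relation between \<open>a\<close> and \<open>a'\<close> alone, whose positive square root is the second claim; with it,
both heights become linear in the two square roots.\<close>

lemma arc_relations:
  fixes q \<Upsilon> a a' b b' p r :: real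
  assumes q: "0 < q" "q < 1" and \<Upsilon>: "1 < \<Upsilon>"
    and a: "0 < a" "a < a'" and b: "0 < b" "0 < b'"
    and circle: "a\<^sup>2 + b\<^sup>2 + 1 = 2 * \<Upsilon> * a" "a'\<^sup>2 + b'\<^sup>2 + 1 = 2 * \<Upsilon> * a'"
    and dot: "(a - \<Upsilon>) * (a' - \<Upsilon>) + b * b' = (\<Upsilon>\<^sup>2 - 1) * (1 - q * a' / \<Upsilon>)"
    and p: "0 < p" "p\<^sup>2 = 2 * \<Upsilon> / a' - q" and r: "0 < r" "r\<^sup>2 = 2 * \<Upsilon> * a - q"
  shows "b' * (\<Upsilon> - a) - b * (\<Upsilon> - a') = (\<Upsilon>\<^sup>2 - 1) * (sqrt q * a' * p / \<Upsilon>)"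
    and "\<Upsilon> * (a + (1 - q) * a') = a' * p * r"
    and "sqrt q * b' = a' * p - r" and "sqrt q * b = r - a * p"
proof -
  define c where "c = sqrt q"
  have c: "0 < c" "c\<^sup>2 = q" using q by (auto simp: c_def)
  define X X' R2 where X: "X = \<Upsilon> - a" and X': "X' = \<Upsilon> - a'" and R2: "R2 = \<Upsilon>\<^sup>2 - 1"
  define t where "t = a' / \<Upsilon>"
  have t: "a' = t * \<Upsilon>" "0 < t" using \<Upsilon> a by (auto simp: t_def)
  have R2pos: "0 < R2" using \<Upsilon> by (simp add: R2 one_less_power)
  have XX: "X\<^sup>2 + b\<^sup>2 = R2" "X'\<^sup>2 + b'\<^sup>2 = R2"
    using circle unfolding X X' R2 by (auto simp: power2_eq_square algebra_simps)
  have dot': "X * X' + b * b' = R2 * (1 - q * t)"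
    using dot unfolding X X' R2 t_def by (simp add: algebra_simps)
  \<comment> \<open>The sine of the angle, scaled by the squared radius.\<close>
  define K where "K = b' * X - b * X'"
  have "X' < X" using a by (simp add: X X')
  then have Kpos: "0 < K" using arc_cross_pos[OF XX] b by (simp add: K_def)
  have p2: "t * p\<^sup>2 = 2 - q * t" using p(2) a \<Upsilon> by (simp add: t_def field_simps)
  have "K\<^sup>2 = R2\<^sup>2 - (X * X' + b * b')\<^sup>2"
  proof -
    have "K\<^sup>2 + (X * X' + b * b')\<^sup>2 = (X\<^sup>2 + b\<^sup>2) * (X'\<^sup>2 + b'\<^sup>2)"
      unfolding K_def by algebra
    then show ?thesis unfolding XX by (simp add: power2_eq_square)
  qed
  also have "\<dots> = R2\<^sup>2 * (q * t * (2 - q * t))"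
    unfolding dot' by algebra
  also have "\<dots> = (R2 * (c * t * p))\<^sup>2"
    using p2 c(2) by algebra
  finally have K: "K = R2 * (c * t * p)"
    using Kpos R2pos c t p by (simp add: power2_eq_iff_nonneg)
  show "b' * (\<Upsilon> - a) - b * (\<Upsilon> - a') = (\<Upsilon>\<^sup>2 - 1) * (sqrt q * a' * p / \<Upsilon>)"
    using K unfolding K_def X X' R2 c_def t_def by simp
  have "R2 * (c * t * p * b') = b' * K" by (simp add: K)
  also have "\<dots> = R2 * (X - (1 - q * t) * X')"
  proof -
    have "b' * K = (X'\<^sup>2 + b'\<^sup>2) * X - (X * X' + b * b') * X'" unfolding K_def by algebra
    then show ?thesis unfolding XX dot' by algebra
  qed
  finally have B': "c * t * p * b' = X - (1 - q * t) * X'" using R2pos by simp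
  have "R2 * (c * t * p * b) = b * K" by (simp add: K)
  also have "\<dots> = R2 * ((1 - q * t) * X - X')"
  proof -
    have "b * K = (X * X' + b * b') * X - (X\<^sup>2 + b\<^sup>2) * X'" unfolding K_def by algebra
    then show ?thesis unfolding XX dot' by algebra
  qed
  finally have B: "c * t * p * b = (1 - q * t) * X - X'" using R2pos by simp
  have b'2: "b'\<^sup>2 = 2 * \<Upsilon> * a' - 1 - a'\<^sup>2" using circle by simp
  have S: "\<Upsilon>\<^sup>2 * (a + (1 - q) * a')\<^sup>2 = (a' * p * r)\<^sup>2"
  proof -
    have "(X - (1 - q * t) * X')\<^sup>2 = q * t * (t * p\<^sup>2) * b'\<^sup>2"
    proof -
      have "(c * t * p * b')\<^sup>2 = c\<^sup>2 * t * (t * p\<^sup>2) * b'\<^sup>2" by algebra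
      then show ?thesis unfolding B' c(2) .
    qed
    then have "(X - (1 - q * t) * X')\<^sup>2 = q * t * (2 - q * t) * b'\<^sup>2" by (simp add: p2)
    then have "\<Upsilon>\<^sup>2 * (a + (1 - q) * a')\<^sup>2 = a' * \<Upsilon> * (2 - q * t) * (2 * \<Upsilon> * a - q)"
      unfolding b'2 X X' t(1) by algebra
    also have "\<dots> = (a' * p * r)\<^sup>2"
      unfolding p2[symmetric] r(2)[symmetric] t(1) by algebra
    finally show ?thesis .
  qed
  have mpos: "0 < a + (1 - q) * a'" using a q by (simp add: add_pos_pos)
  show m: "\<Upsilon> * (a + (1 - q) * a') = a' * p * r"
    using S mpos a p r \<Upsilon> by (simp add: power_mult_distrib[symmetric] power2_eq_iff_nonneg del: power_mult_distrib)
  have m': "t * p * r = a + (1 - q) * a'" using m \<Upsilon> by (simp add: t(1))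
  have "t * p * (c * b') = t * p * (a' * p - r)"
  proof -
    have "t * p * (a' * p - r) = a' * (t * p\<^sup>2) - t * p * r" by algebra
    also have "\<dots> = X - (1 - q * t) * X'" unfolding p2 m' X X' t(1) by algebra
    finally show ?thesis using B' by (simp add: mult_ac)
  qed
  then show "sqrt q * b' = a' * p - r" using t p by (simp add: c_def)
  have "t * p * (c * b) = t * p * (r - a * p)"
  proof -
    have "t * p * (r - a * p) = t * p * r - a * (t * p\<^sup>2)" by algebra
    also have "\<dots> = (1 - q * t) * X - X'" unfolding p2 m' X X' t(1) by algebra
    finally show ?thesis using B by (simp add: mult_ac)
  qed
  then show "sqrt q * b = r - a * p" using t p by (simp add: c_def)
qed

section \<open>The constants and their reciprocal symmetry\<close>

locale item_f_constants =
  fixes N :: nat and q \<Upsilon> :: real and a b :: "nat \<Rightarrow> real"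
  assumes N: "1 \<le> N" and q: "0 < q" "q < 1"
    and constants: "ITEM_f_constants N q \<Upsilon> a b"
begin

text \<open>In the notation of the constants, \<open>R\<close> is the radius of the circle and \<open>\<Upsilon>\<close> the abscissa of its
centre; since \<open>R\<^sup>2 = \<Upsilon>\<^sup>2 - 1\<close>, it is orthogonal to the unit circle.\<close>

definition R :: real where "R = sqrt (\<Upsilon>\<^sup>2 - 1)"

abbreviation \<phi> :: "nat \<Rightarrow> real" where "\<phi> \<equiv> ITEM_f_phi N q \<Upsilon> a"

lemma Upsilon_gt_1: "1 < \<Upsilon>"
  and a_0: "a 0 = 1 / \<Upsilon>"
  and a_less_Suc: "k \<le> N \<Longrightarrow> a k < a (k + 1)"
  and a_last: "a (N + 1) = \<Upsilon>"
  and b_pos: "k \<le> N + 1 \<Longrightarrow> 0 < b k"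
  using constants by (auto simp: ITEM_f_constants_def Let_def)

lemma R_pos: "0 < R" and R_square: "R\<^sup>2 = \<Upsilon>\<^sup>2 - 1"
proof -
  have "0 < \<Upsilon>\<^sup>2 - 1" using Upsilon_gt_1 by (simp add: one_less_power)
  then show "0 < R" "R\<^sup>2 = \<Upsilon>\<^sup>2 - 1" by (auto simp: R_def)
qed

lemma circle:
  assumes "1 \<le> k" "k \<le> N"
  shows "(a k)\<^sup>2 + (b k)\<^sup>2 + 1 = 2 * \<Upsilon> * a k"
proof -
  have "(norm ((a k, b k) - (\<Upsilon>, 0)))\<^sup>2 = (sqrt (\<Upsilon>\<^sup>2 - 1))\<^sup>2"
    using constants assms by (auto simp: ITEM_f_constants_def Let_def)
  then have "(a k - \<Upsilon>)\<^sup>2 + (b k)\<^sup>2 = \<Upsilon>\<^sup>2 - 1"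
    using R_square by (simp add: norm_Pair R_def)
  then show ?thesis by (simp add: power2_eq_square algebra_simps)
qed

lemma dot:
  assumes "k \<le> N"
  shows "(a k - \<Upsilon>) * (a (k + 1) - \<Upsilon>) + b k * b (k + 1) = (\<Upsilon>\<^sup>2 - 1) * (1 - q * a (k + 1) / \<Upsilon>)"
proof -
  have "((a k, b k) - (\<Upsilon>, 0)) \<bullet> ((a (k + 1), b (k + 1)) - (\<Upsilon>, 0))
      = (sqrt (\<Upsilon>\<^sup>2 - 1))\<^sup>2 * (1 - q * a (k + 1) / \<Upsilon>)"
    using constants assms unfolding ITEM_f_constants_def Let_def by blast
  then show ?thesis using R_square by (simp add: R_def)
qed

lemma b_0: "b 0 = sqrt (1 - q) * R / \<Upsilon>" and b_last: "b (N + 1) = sqrt (1 - q) * R"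
  using constants by (auto simp: ITEM_f_constants_def Let_def R_def)

lemma a_strict_mono:
  assumes "i < j" "j \<le> N + 1"
  shows "a i < a j"
  using assms
proof (induction j)
  case (Suc j)
  then show ?case using a_less_Suc[of j] by (cases "i = j") auto
qed simp

lemma a_gt: "1 \<le> k \<Longrightarrow> k \<le> N + 1 \<Longrightarrow> 1 / \<Upsilon> < a k"
  using a_strict_mono[of 0 k] a_0 by simp

lemma a_less: "k \<le> N \<Longrightarrow> a k < \<Upsilon>"
  using a_strict_mono[of k "N + 1"] a_last by simp

lemma a_pos: "k \<le> N + 1 \<Longrightarrow> 0 < a k"
  using a_gt[of k] a_0 Upsilon_gt_1 by (cases "k = 0") (auto intro: less_trans[of 0 "1 / \<Upsilon>"])

text \<open>The conditions that involve the two extra points, which are off the circle, determine the first and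
the last point on it: they say \<open>b\<^sub>N = \<surd>(1 - q) R\<close> and \<open>b\<^sub>1 = \<surd>(1 - q) R a\<^sub>1\<close>, and intersecting these lines
with the circle leaves two candidates each, of which the ordering of the abscissas excludes one.\<close>

lemma b_N: "b N = sqrt (1 - q) * R"
proof -
  have "b N * (sqrt (1 - q) * R) = R\<^sup>2 * (1 - q)"
    using dot[of N] Upsilon_gt_1 by (simp add: a_last[simplified] b_last[simplified] R_square)
  also have "\<dots> = (sqrt (1 - q) * R) * (sqrt (1 - q) * R)"
    using q by (simp add: power2_eq_square)
  finally show ?thesis using R_pos q by simp
qed

lemma a_N: "a N = \<Upsilon> - sqrt q * R"
proof -
  have "(\<Upsilon> - a N)\<^sup>2 = \<Upsilon>\<^sup>2 - 1 - (b N)\<^sup>2"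
    using circle[of N] N by (simp add: power2_eq_square algebra_simps)
  also have "\<dots> = (sqrt q * R)\<^sup>2"
    using q by (simp add: b_N power_mult_distrib R_square algebra_simps)
  finally show ?thesis using a_less[of N] q R_pos by (simp add: power2_eq_iff_nonneg)
qed

lemma b_1: "b 1 = sqrt (1 - q) * R * a 1"
proof -
  have "(1 / \<Upsilon> - \<Upsilon>) * (a 1 - \<Upsilon>) + sqrt (1 - q) * R / \<Upsilon> * b 1 = R\<^sup>2 * (1 - q * a 1 / \<Upsilon>)"
    using dot[of 0] by (simp add: a_0 b_0 R_square)
  moreover have "1 / \<Upsilon> - \<Upsilon> = - R\<^sup>2 / \<Upsilon>"
    unfolding R_square using Upsilon_gt_1 by (simp add: field_simps power2_eq_square)
  ultimately have "R * (sqrt (1 - q) * b 1) = R * ((1 - q) * R * a 1)"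
    using Upsilon_gt_1 by (simp add: field_simps power2_eq_square)
  then have "sqrt (1 - q) * b 1 = sqrt (1 - q) * (sqrt (1 - q) * R * a 1)"
    using R_pos q by simp
  then show ?thesis using q by simp
qed

lemma a_N_conjugate: "(\<Upsilon> - sqrt q * R) * (\<Upsilon> + sqrt q * R) = 1 + (1 - q) * R\<^sup>2"
  using q by (simp add: algebra_simps power2_eq_square[symmetric] R_square power_mult_distrib)

lemma a_1_a_N: "a 1 * a N = 1"
proof -
  have "(a 1)\<^sup>2 + (sqrt (1 - q) * R * a 1)\<^sup>2 + 1 = 2 * \<Upsilon> * a 1"
    using circle[of 1] N unfolding b_1 by simp
  moreover have "(sqrt (1 - q) * R * a 1)\<^sup>2 = (1 - q) * R\<^sup>2 * (a 1)\<^sup>2"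
    using q by (simp add: power_mult_distrib)
  ultimately have "(a 1)\<^sup>2 * (1 + (1 - q) * R\<^sup>2) + 1 = 2 * \<Upsilon> * a 1"
    by (simp add: algebra_simps)
  then have "(a 1 * (\<Upsilon> - sqrt q * R) - 1) * (a 1 * (\<Upsilon> + sqrt q * R) - 1) = 0"
    unfolding a_N_conjugate[symmetric] by (simp add: algebra_simps power2_eq_square)
  moreover have "1 < a 1 * (\<Upsilon> + sqrt q * R)"
  proof -
    have "1 < a 1 * \<Upsilon>" using a_gt[of 1] Upsilon_gt_1 by (simp add: field_simps)
    moreover have "0 < a 1 * (sqrt q * R)" using a_pos[of 1] R_pos q by simp
    ultimately show ?thesis by (simp add: distrib_left)
  qed
  ultimately show ?thesis by (simp add: a_N)
qed

lemma radicands_pos: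
  assumes "k \<le> N"
  shows "0 < 2 * \<Upsilon> / a (k + 1) - q" "0 < 2 * \<Upsilon> * a k - q"
proof -
  have "a (k + 1) \<le> \<Upsilon>" using a_less[of "k + 1"] a_last assms by (cases "k = N") auto
  then have "2 \<le> 2 * \<Upsilon> / a (k + 1)" using a_pos[of "k + 1"] assms by (simp add: field_simps)
  then show "0 < 2 * \<Upsilon> / a (k + 1) - q" using q by simp
  have "1 / \<Upsilon> \<le> a k" using a_gt[of k] a_0 assms by (cases "k = 0") auto
  then have "2 \<le> 2 * \<Upsilon> * a k" using Upsilon_gt_1 by (simp add: field_simps)
  then show "0 < 2 * \<Upsilon> * a k - q" using q by simp
qed

text \<open>The square roots appear by their explicit formulas because the symmetry that identifies the first of
them as \<open>\<phi>\<^sub>N\<^sub>-\<^sub>k\<close> is itself derived from these relations.\<close>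

lemma arc:
  assumes k: "1 \<le> k" "k < N"
  defines "p \<equiv> sqrt (2 * \<Upsilon> / a (k + 1) - q)" and "r \<equiv> sqrt (2 * \<Upsilon> * a k - q)"
  shows "0 < p" "0 < r" "p\<^sup>2 = 2 * \<Upsilon> / a (k + 1) - q" "r\<^sup>2 = 2 * \<Upsilon> * a k - q"
    and "b (k + 1) * (\<Upsilon> - a k) - b k * (\<Upsilon> - a (k + 1)) = R\<^sup>2 * (sqrt q * a (k + 1) * p / \<Upsilon>)"
    and "\<Upsilon> * (a k + (1 - q) * a (k + 1)) = a (k + 1) * p * r"
    and "sqrt q * b (k + 1) = a (k + 1) * p - r" and "sqrt q * b k = r - a k * p"
proof -
  show pr: "0 < p" "0 < r" "p\<^sup>2 = 2 * \<Upsilon> / a (k + 1) - q" "r\<^sup>2 = 2 * \<Upsilon> * a k - q"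
    using radicands_pos[of k] k by (auto simp: p_def r_def)
  have k': "1 \<le> k + 1" "k + 1 \<le> N" "k \<le> N" using k by auto
  note rel = arc_relations[OF q Upsilon_gt_1 a_pos a_less_Suc b_pos b_pos
      circle[OF k(1) k'(3)] circle[OF k'(1,2)] dot pr(1,3,2,4), OF _ k'(3) _ _ k'(3)]
  show "b (k + 1) * (\<Upsilon> - a k) - b k * (\<Upsilon> - a (k + 1)) = R\<^sup>2 * (sqrt q * a (k + 1) * p / \<Upsilon>)"
    "\<Upsilon> * (a k + (1 - q) * a (k + 1)) = a (k + 1) * p * r"
    "sqrt q * b (k + 1) = a (k + 1) * p - r" "sqrt q * b k = r - a k * p"
    using rel k by (auto simp: R_square)
qed

text \<open>The map \<open>(a, b) \<mapsto> (1/a, b/a)\<close> preserves the circle and the condition on consecutive points but reverses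
their order, and it exchanges the first and the last point. Each point determines the next one, in
either direction, so the whole sequence is invariant.\<close>

lemma reciprocal:
  assumes "1 \<le> k" "k \<le> N"
  shows "a k * a (N + 1 - k) = 1"
  using assms
proof (induction k rule: dec_induct)
  case base
  then show ?case using a_1_a_N by simp
next
  case (step j)
  define j' where "j' = N - j"
  have j': "1 \<le> j'" "j' < N" "j' + 1 = N + 1 - j" "j' = N + 1 - Suc j"
    using step by (auto simp: j'_def)
  have j: "1 \<le> j" "j < N" using step by auto
  define r where "r = sqrt (2 * \<Upsilon> * a j - q)"
  define p where "p = sqrt (2 * \<Upsilon> / a (j + 1) - q)"
  define r' where "r' = sqrt (2 * \<Upsilon> * a j' - q)"
  have IH: "a j * a (j' + 1) = 1" using step j' by simp
  have aj: "0 < a j" "0 < a (j + 1)" "0 < a (j' + 1)" using a_pos j j' by auto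
  then have d': "a (j' + 1) = 1 / a j" using IH by (simp add: field_simps)
  have "(a j * b (j' + 1))\<^sup>2 = (b j)\<^sup>2"
  proof -
    have "(b (j' + 1))\<^sup>2 = 2 * \<Upsilon> * a (j' + 1) - 1 - (a (j' + 1))\<^sup>2"
      using circle[of "j' + 1"] j' by simp
    moreover have "(b j)\<^sup>2 = 2 * \<Upsilon> * a j - 1 - (a j)\<^sup>2"
      using circle[of j] j by simp
    ultimately have "(a j * b (j' + 1))\<^sup>2
        = 2 * \<Upsilon> * a j * (a j * a (j' + 1)) - (a j)\<^sup>2 - (a j * a (j' + 1))\<^sup>2 \<and>
        (b j)\<^sup>2 = 2 * \<Upsilon> * a j - 1 - (a j)\<^sup>2"
      unfolding power_mult_distrib by algebra
    then show ?thesis unfolding IH by simp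
  qed
  then have b': "a j * b (j' + 1) = b j"
    using b_pos[of j] b_pos[of "j' + 1"] aj j j' by (simp add: power2_eq_iff_nonneg)
  have r_eq: "sqrt (2 * \<Upsilon> / a (j' + 1) - q) = r" using d' by (simp add: r_def)
  note A = arc[OF j, folded r_def p_def] and A' = arc[OF j'(1,2), unfolded r_eq, folded r'_def]
  \<comment> \<open>The step from \<open>j\<close> upwards and the step from \<open>j' + 1\<close> downwards share the root \<open>r\<close>; the other roots agree as well.\<close>
  have "a j * r' = r - sqrt q * b j"
  proof -
    have "a j * (sqrt q * b (j' + 1)) = a j * (a (j' + 1) * r - r')" using A'(7) by simp
    then have "sqrt q * b j = (a j * a (j' + 1)) * r - a j * r'"
      using b' by (simp add: algebra_simps)
    then show ?thesis unfolding IH by simp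
  qed
  then have r': "r' = p" using A(8) aj by simp
  have "a j * (\<Upsilon> * (a j' + (1 - q) * a (j' + 1))) = (a j * a (j' + 1)) * r * p"
    using A'(6) by (simp add: r' mult_ac)
  also have "a j * (\<Upsilon> * (a j' + (1 - q) * a (j' + 1)))
      = \<Upsilon> * (a j * a j' + (1 - q) * (a j * a (j' + 1)))" by algebra
  finally have "\<Upsilon> * (a j * a j' + (1 - q)) = r * p" unfolding IH by simp
  then have 1: "a j * a j' + (1 - q) = r * p / \<Upsilon>" using Upsilon_gt_1 by (simp add: field_simps)
  have "a j / a (j + 1) + (1 - q) = r * p / \<Upsilon>"
    using A(6) aj Upsilon_gt_1 by (simp add: field_simps)
  then have "a j * a j' = a j / a (j + 1)" using 1 by simp
  then have "a (j + 1) * a j' = 1" using aj by (simp add: field_simps)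
  then show ?case using j'(4) by simp
qed

lemma phi_0: "\<phi> 0 = sqrt (1 - q)" by (simp add: ITEM_f_phi_def)

lemma phi_N: "\<phi> N = ((1 - q) * \<Upsilon> + a N) / sqrt (1 - q)"
  using N by (simp add: ITEM_f_phi_def)

lemma phi_pos:
  assumes "k \<le> N"
  shows "0 < \<phi> k"
proof -
  have "0 < (1 - q) * \<Upsilon> + a N" using q Upsilon_gt_1 a_pos[of N] by (simp add: add_pos_pos)
  then show ?thesis
    using radicands_pos(2)[OF assms] q by (auto simp: ITEM_f_phi_def)
qed

lemma phi_reflected:
  assumes "1 \<le> k" "k < N"
  shows "\<phi> (N - k) = sqrt (2 * \<Upsilon> / a (k + 1) - q)"
proof -
  have "a (k + 1) * a (N - k) = 1" using reciprocal[of "k + 1"] assms by simp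
  then have "a (N - k) = 1 / a (k + 1)" using a_pos[of "k + 1"] assms by (simp add: field_simps)
  then show ?thesis using assms by (auto simp: ITEM_f_phi_def)
qed

text \<open>Here the symmetry enters: the radicand of \<open>\<phi>\<^sub>N\<^sub>-\<^sub>k\<close> is \<open>2 \<Upsilon> / a\<^sub>k\<^sub>+\<^sub>1 - q\<close>, so the two roots attached to an
arc are \<open>\<phi>\<^sub>k\<close> and \<open>\<phi>\<^sub>N\<^sub>-\<^sub>k\<close>.\<close>

lemma phi_relations:
  assumes k: "1 \<le> k" "k < N"
  defines "p \<equiv> \<phi> (N - k)" and "r \<equiv> \<phi> k"
  shows "r\<^sup>2 = 2 * \<Upsilon> * a k - q"
    and "sqrt q * b (k + 1) = a (k + 1) * p - r" and "sqrt q * b k = r - a k * p"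
  using arc[OF k] k phi_reflected[OF k] by (auto simp: p_def r_def ITEM_f_phi_def)

text \<open>The exceptional definitions of \<open>\<phi>\<^sub>0\<close> and \<open>\<phi>\<^sub>N\<close> are made so that this identity extends from the arcs of
the circle to the first step.\<close>

lemma phi_product:
  assumes k: "k < N"
  shows "\<Upsilon> * (a k + (1 - q) * a (k + 1)) = a (k + 1) * \<phi> (N - k) * \<phi> k"
proof (cases "k = 0")
  case True
  have "a 1 * ((1 - q) * \<Upsilon> + a N) = (1 - q) * \<Upsilon> * a 1 + 1"
    using a_1_a_N by (simp add: algebra_simps)
  then have "a 1 * \<phi> N * \<phi> 0 = (1 - q) * \<Upsilon> * a 1 + 1"
    using q by (simp add: phi_0 phi_N)
  then show ?thesis using True Upsilon_gt_1 by (simp add: a_0 algebra_simps)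
next
  case False
  then show ?thesis using arc(6)[of k] k phi_reflected[of k] by (simp add: ITEM_f_phi_def)
qed

end

section \<open>The explicit rate\<close>

context item_f_constants
begin

text \<open>With \<open>t\<close> the angle at the centre, measured from the ray towards the origin, this is \<open>tan (t/2)\<close>.\<close>

definition half_angle :: "nat \<Rightarrow> real" where
  "half_angle k = b k / (R + \<Upsilon> - a k)"

text \<open>The tangent of half the angle of an arc is \<open>\<surd>q / p\<close> with the root \<open>p\<close> of \<open>arc\<close>, so the addition theorem relates the two values
\<open>h\<close> and \<open>h'\<close> by \<open>h (p + \<surd>q h') = p h' - \<surd>q\<close>. The claim then amounts to \<open>p h' \<le> 1 + (1 - \<surd>q) h'\<^sup>2\<close>, and this
follows by squaring, because the centre lies at a distance of at least \<open>R\<close> from the origin.\<close>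

lemma half_angle_step:
  assumes k: "1 \<le> k" "k < N"
  shows "half_angle k \<le> (1 - sqrt q) * half_angle (k + 1)"
proof -
  define c where "c = sqrt q"
  have c: "0 < c" "c < 1" "c\<^sup>2 = q" using q by (auto simp: c_def)
  define p where "p = sqrt (2 * \<Upsilon> / a (k + 1) - q)"
  define r where "r = sqrt (2 * \<Upsilon> * a k - q)"
  define X X' where X: "X = \<Upsilon> - a k" and X': "X' = \<Upsilon> - a (k + 1)"
  note A = arc[OF k, folded p_def r_def c_def X X']
  have a': "0 < a (k + 1)" using a_pos k by simp
  have Xpos: "0 < X" "0 < X'" using a_less[of k] a_less[of "k + 1"] k by (auto simp: X X')
  define h h' where h: "h = half_angle k" and h': "h' = half_angle (k + 1)"
  have bu: "b k = h * (R + X)" "b (k + 1) = h' * (R + X')"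
  proof -
    have eq: "R + \<Upsilon> - a k = R + X" "R + \<Upsilon> - a (k + 1) = R + X'" by (simp_all add: X X')
    show "b k = h * (R + X)" "b (k + 1) = h' * (R + X')"
      unfolding h h' half_angle_def eq using Xpos R_pos by simp_all
  qed
  have hpos: "0 < h" "0 < h'"
    using b_pos[of k] b_pos[of "k + 1"] k Xpos R_pos
    by (auto simp: h h' half_angle_def X X' algebra_simps intro!: divide_pos_pos)
  have p2: "p\<^sup>2 * a (k + 1) = 2 * \<Upsilon> - q * a (k + 1)" using A(3) a' by (simp add: field_simps)
  have dot': "X * X' + b k * b (k + 1) = R\<^sup>2 * (1 - q * a (k + 1) / \<Upsilon>)"
    using dot[of k] k by (simp add: R_square X X' algebra_simps)
  have "p * (b (k + 1) * X - b k * X') = c * (R\<^sup>2 * (p\<^sup>2 * a (k + 1) / \<Upsilon>))"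
    unfolding A(5) by (simp add: power2_eq_square)
  also have "p\<^sup>2 * a (k + 1) / \<Upsilon> = 2 - q * a (k + 1) / \<Upsilon>"
    unfolding p2 using Upsilon_gt_1 by (simp add: field_simps)
  also have "R\<^sup>2 * (2 - q * a (k + 1) / \<Upsilon>) = R\<^sup>2 + (X * X' + b k * b (k + 1))"
    unfolding dot' by algebra
  finally have cross: "p * (b (k + 1) * X - b k * X') = c * (R\<^sup>2 + (X * X' + b k * b (k + 1)))" .
  have chord: "p * (b (k + 1) - b k) = c * (X + X')"
  proof -
    have pr: "p * r = \<Upsilon> * (a k + (1 - q) * a (k + 1)) / a (k + 1)"
      using A(6) a' by (simp add: field_simps)
    have "c * (p * (b (k + 1) - b k)) = p * (c * b (k + 1) - c * b k)" by algebra
    also have "\<dots> = (a k + a (k + 1)) * p\<^sup>2 - 2 * (p * r)"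
      unfolding A(7,8) by algebra
    also have "\<dots> = q * (X + X')"
      unfolding A(3) pr X X' using a' by (simp add: field_simps)
    also have "\<dots> = c * (c * (X + X'))" using c(3) by (simp add: power2_eq_square)
    finally show ?thesis using c by simp
  qed
  \<comment> \<open>The equations for chord and cross product add up to the addition theorem for half the angles.\<close>
  have "p * (b (k + 1) * (R + X) - b k * (R + X'))
      = R * (p * (b (k + 1) - b k)) + p * (b (k + 1) * X - b k * X')" by algebra
  also have "\<dots> = c * ((R + X) * (R + X') + b k * b (k + 1))"
    unfolding chord cross by algebra
  finally have "((R + X) * (R + X')) * (p * (h' - h)) = ((R + X) * (R + X')) * (c * (1 + h * h'))"
    unfolding bu by algebra
  then have tan: "p * (h' - h) = c * (1 + h * h')"
    using Xpos R_pos by simp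
  have "(b (k + 1))\<^sup>2 = (R - X') * (R + X')"
    using circle[of "k + 1"] k R_square by (simp add: X' power2_eq_square algebra_simps)
  then have "(R + X') * (h'\<^sup>2 * (R + X')) = (R + X') * (R - X')"
    unfolding bu by algebra
  then have h2: "h'\<^sup>2 * (R + X') = R - X'" using Xpos R_pos by simp
  have "p * h' \<le> 1 + (1 - c) * h'\<^sup>2"
  proof (rule power2_le_imp_le)
    have "R \<le> \<Upsilon>" by (rule power2_le_imp_le) (use R_square Upsilon_gt_1 in auto)
    then have "R * X' \<le> \<Upsilon> * X'" using Xpos by simp
    then have le: "\<Upsilon> * (R - X') \<le> R * a (k + 1)" by (simp add: X' algebra_simps)
    have "(R + X') * (2 * \<Upsilon> * h'\<^sup>2) \<le> (R + X') * (a (k + 1) * (1 + h'\<^sup>2))"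
    proof -
      have "(R + X') * (2 * \<Upsilon> * h'\<^sup>2) = 2 * (\<Upsilon> * (R - X'))" using h2 by algebra
      moreover have "(R + X') * (a (k + 1) * (1 + h'\<^sup>2)) = 2 * (R * a (k + 1))"
        using h2 by algebra
      ultimately show ?thesis using le by linarith
    qed
    then have "2 * \<Upsilon> * h'\<^sup>2 \<le> a (k + 1) * (1 + h'\<^sup>2)" using Xpos R_pos by simp
    moreover have "a (k + 1) * (p\<^sup>2 * h'\<^sup>2) = 2 * \<Upsilon> * h'\<^sup>2 - a (k + 1) * (q * h'\<^sup>2)"
      using p2 by algebra
    ultimately have "a (k + 1) * (p\<^sup>2 * h'\<^sup>2) \<le> a (k + 1) * (1 + (1 - q) * h'\<^sup>2)"
      by (simp add: algebra_simps)
    then have "(p * h')\<^sup>2 \<le> 1 + (1 - c\<^sup>2) * h'\<^sup>2" using a' by (simp add: power_mult_distrib c)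
    also have "\<dots> \<le> (1 + (1 - c) * h'\<^sup>2)\<^sup>2"
    proof -
      have "(1 + (1 - c) * h'\<^sup>2)\<^sup>2 - (1 + (1 - c\<^sup>2) * h'\<^sup>2) = ((1 - c) * h')\<^sup>2 * (1 + h'\<^sup>2)"
        by algebra
      then show ?thesis by (smt (verit) mult_nonneg_nonneg zero_le_power2)
    qed
    finally show "(p * h')\<^sup>2 \<le> (1 + (1 - c) * h'\<^sup>2)\<^sup>2" .
    show "0 \<le> 1 + (1 - c) * h'\<^sup>2" using c by simp
  qed
  then have "c * (p * h') \<le> c * (1 + (1 - c) * h'\<^sup>2)" using c by simp
  moreover have "(p + c * h') * h = p * h' - c" using tan by algebra
  ultimately have "(p + c * h') * h \<le> (p + c * h') * ((1 - c) * h')"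
    by (simp add: algebra_simps power2_eq_square)
  then have "h \<le> (1 - c) * h'" using A(1) c hpos by (simp add: mult_le_cancel_left_pos add_pos_pos)
  then show ?thesis by (simp add: h h' c_def)
qed

text \<open>Iterating the contraction over the \<open>N - 1\<close> arcs compares the end points, whose half-angle tangents are
explicit: \<open>\<surd>(1 - q) / ((1 - \<surd>q) (R + \<Upsilon>))\<close> and \<open>\<surd>(1 - q) / (1 + \<surd>q)\<close>. Hence
\<open>1 + \<surd>q \<le> (1 - \<surd>q)\<^sup>N (R + \<Upsilon>)\<close>, and \<open>R < \<Upsilon>\<close>.\<close>

lemma inverse_Upsilon_square_le: "1 / \<Upsilon>\<^sup>2 \<le> 4 * (1 - sqrt q) ^ (2 * N)"
proof -
  define c where "c = sqrt q"
  have c: "0 < c" "c < 1" "c\<^sup>2 = q" using q by (auto simp: c_def)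
  define s where "s = sqrt (1 - q)"
  have s: "0 < s" using q by (simp add: s_def)
  have geom: "half_angle 1 \<le> (1 - c) ^ (k - 1) * half_angle k" if "1 \<le> k" "k \<le> N" for k
    using that
  proof (induction k rule: dec_induct)
    case (step k)
    have "half_angle 1 \<le> (1 - c) ^ (k - 1) * half_angle k" using step by simp
    also have "\<dots> \<le> (1 - c) ^ (k - 1) * ((1 - c) * half_angle (k + 1))"
      using half_angle_step[of k] step c by (intro mult_left_mono) (auto simp: c_def)
    also have "\<dots> = (1 - c) ^ (Suc k - 1) * half_angle (Suc k)"
      using step by (simp add: power_eq_if)
    finally show ?case .
  qed simp
  have top: "half_angle N = s / (1 + c)"
  proof -
    have "half_angle N = (s * R) / ((1 + c) * R)"
      by (simp add: half_angle_def b_N a_N s_def c_def algebra_simps)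
    then show ?thesis using R_pos by simp
  qed
  have bottom: "half_angle 1 * ((1 - c) * (R + \<Upsilon>)) = s"
  proof -
    have a1: "a 1 * (\<Upsilon> - c * R) = 1" using a_1_a_N by (simp add: a_N c_def)
    have "(R + \<Upsilon> - a 1) * (\<Upsilon> - c * R) = R * ((1 - c) * (R + \<Upsilon>))"
      using a1 R_square by algebra
    moreover have "0 < \<Upsilon> - c * R" using a_pos[of N] by (simp add: a_N c_def)
    moreover have "0 < R + \<Upsilon> - a 1" using a_less[of 1] N R_pos by simp
    moreover have "half_angle 1 * (R + \<Upsilon> - a 1) = s * R * a 1"
      using calculation by (simp add: half_angle_def b_1[simplified] s_def)
    ultimately have "R * (half_angle 1 * ((1 - c) * (R + \<Upsilon>))) = R * s"
      using a1 by algebra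
    then show ?thesis using R_pos by simp
  qed
  have R_le: "R \<le> \<Upsilon>" by (rule power2_le_imp_le) (use R_square Upsilon_gt_1 in auto)
  have "s * (1 + c) = half_angle 1 * ((1 - c) * (R + \<Upsilon>)) * (1 + c)" unfolding bottom ..
  also have "\<dots> \<le> ((1 - c) ^ (N - 1) * half_angle N) * ((1 - c) * (R + \<Upsilon>)) * (1 + c)"
    using geom[of N] N c R_pos Upsilon_gt_1 by (intro mult_right_mono) auto
  also have "\<dots> = s * ((1 - c) ^ N * (R + \<Upsilon>))"
    using c N by (simp add: top power_eq_if)
  finally have "1 + c \<le> (1 - c) ^ N * (R + \<Upsilon>)" using s by simp
  also have "\<dots> \<le> (1 - c) ^ N * (2 * \<Upsilon>)" using R_le c by (intro mult_left_mono) auto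
  finally have "1 \<le> (1 - c) ^ N * (2 * \<Upsilon>)" using c by simp
  then have "1 / \<Upsilon> \<le> 2 * (1 - c) ^ N" using Upsilon_gt_1 by (simp add: field_simps)
  then have "(1 / \<Upsilon>)\<^sup>2 \<le> (2 * (1 - c) ^ N)\<^sup>2" using Upsilon_gt_1 by (intro power_mono) auto
  then show ?thesis
    by (simp add: power_mult_distrib power_divide power_mult[symmetric] mult.commute[of N] c_def)
qed

end

section \<open>A quadratic potential\<close>

lemma inner_lincomb3:
  fixes u e g :: "'v::real_inner"
  shows "(x1 *\<^sub>R u + x2 *\<^sub>R e + x3 *\<^sub>R g) \<bullet> (y1 *\<^sub>R u + y2 *\<^sub>R e + y3 *\<^sub>R g)
    = x1 * y1 * (u \<bullet> u) + x2 * y2 * (e \<bullet> e) + x3 * y3 * (g \<bullet> g)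
      + (x1 * y2 + x2 * y1) * (u \<bullet> e) + (x1 * y3 + x3 * y1) * (u \<bullet> g) + (x2 * y3 + x3 * y2) * (e \<bullet> g)"
  by (simp add: inner_add_left inner_add_right inner_commute algebra_simps)

context item_f_constants
begin

text \<open>The quadratic part of the potential, in the last gradient step \<open>u\<close> and the momentum \<open>e\<close>. The heights
of the points on the circle are its mixed coefficients.\<close>

definition potential :: "nat \<Rightarrow> 'v::real_inner \<Rightarrow> 'v \<Rightarrow> real" where
  "potential k u e = q * (a k - 1 / (2 * \<Upsilon>)) * (norm u)\<^sup>2 + sqrt q * b k * (u \<bullet> e) + \<Upsilon> / 2 * (norm e)\<^sup>2"

lemma potential_first:
  fixes x g :: "'v::real_inner"
  shows "potential 1 (x - g) (- (\<phi> 0 / \<Upsilon>) *\<^sub>R g)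
    = (q * (1 - q) * (norm x)\<^sup>2 + (norm (g - q *\<^sub>R x))\<^sup>2) / (2 * \<Upsilon>)
      - (a 1 - a 0) * ((g - q *\<^sub>R x) \<bullet> (x - g))"
proof -
  have "sqrt q * b 1 * \<phi> 0 = (sqrt (1 - q))\<^sup>2 * (a 1 * (sqrt q * R))"
    unfolding b_1 phi_0 by algebra
  also have "\<dots> = (1 - q) * (a 1 * \<Upsilon> - a 1 * a N)"
    using q by (simp add: a_N algebra_simps)
  finally have cross: "sqrt q * b 1 * (\<phi> 0 / \<Upsilon>) = (1 - q) * (a 1 - 1 / \<Upsilon>)"
    using a_1_a_N Upsilon_gt_1 by (simp add: field_simps)
  have sq: "\<Upsilon> / 2 * (\<phi> 0 / \<Upsilon>)\<^sup>2 = (1 - q) / (2 * \<Upsilon>)"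
    using q Upsilon_gt_1 by (simp add: phi_0 power_divide power2_eq_square)
  have "potential 1 (x - g) (- (\<phi> 0 / \<Upsilon>) *\<^sub>R g)
    = q * (a 1 - 1 / (2 * \<Upsilon>)) * (x \<bullet> x - 2 * (x \<bullet> g) + g \<bullet> g)
      - sqrt q * b 1 * (\<phi> 0 / \<Upsilon>) * (x \<bullet> g - g \<bullet> g) + \<Upsilon> / 2 * (\<phi> 0 / \<Upsilon>)\<^sup>2 * (g \<bullet> g)"
    unfolding potential_def power2_norm_eq_inner
    by (simp add: inner_diff_left inner_diff_right inner_commute algebra_simps power2_eq_square)
  also have "\<dots> = (q * (1 - q) * (x \<bullet> x) + (g \<bullet> g - 2 * q * (x \<bullet> g) + q\<^sup>2 * (x \<bullet> x))) / (2 * \<Upsilon>)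
      - (a 1 - a 0) * (x \<bullet> g - g \<bullet> g - q * (x \<bullet> x) + q * (x \<bullet> g))"
    unfolding cross sq a_0 using Upsilon_gt_1 by (simp add: field_simps power2_eq_square)
  also have "\<dots> = (q * (1 - q) * (norm x)\<^sup>2 + (norm (g - q *\<^sub>R x))\<^sup>2) / (2 * \<Upsilon>)
      - (a 1 - a 0) * ((g - q *\<^sub>R x) \<bullet> (x - g))"
    unfolding power2_norm_eq_inner
    by (simp add: inner_diff_left inner_diff_right inner_commute algebra_simps power2_eq_square)
  finally show ?thesis .
qed

text \<open>One step changes the quadratic part by exactly the two inner products that the interpolation
inequalities produce. The six coefficients of the quadratic form in \<open>u\<close>, \<open>e\<close>, \<open>g\<close> agree by the relations
for an arc; this is what determines the step sizes of the method.\<close>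

lemma potential_Suc:
  fixes u e g :: "'v::real_inner"
  assumes k: "1 \<le> k" "k < N"
  defines "x \<equiv> u + (\<phi> (N - k) / (1 - q)) *\<^sub>R e"
  shows "potential (k + 1) (x - g) ((a k / ((1 - q) * a (k + 1))) *\<^sub>R e - (\<phi> k / \<Upsilon>) *\<^sub>R g)
    = potential k u e + a k * ((g - q *\<^sub>R x) \<bullet> u) - a (k + 1) * ((g - q *\<^sub>R x) \<bullet> (x - g))"
proof -
  define A A' B B' r s i where "A = a k" and "A' = a (k + 1)" and "B = sqrt q * b k"
    and "B' = sqrt q * b (k + 1)" and "r = \<phi> k" and "s = 1 - q" and "i = 1 / \<Upsilon>"
  define P \<sigma> where "P = \<phi> (N - k) / s" and "\<sigma> = A / (s * A')"
  note defs = A_def A'_def B_def B'_def r_def s_def i_def P_def \<sigma>_def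
  have s: "0 < s" and A': "0 < A'" using q a_pos[of "k + 1"] k by (auto simp: s_def A'_def)
  have i: "\<Upsilon> * i = 1" using Upsilon_gt_1 by (simp add: i_def)
  have p: "\<phi> (N - k) = s * P" using s by (simp add: P_def)
  have A: "A = s * A' * \<sigma>" using s A' by (simp add: \<sigma>_def)
  have B': "B' = A' * s * P - r" and B: "B = r - A * s * P" and r2: "r\<^sup>2 = 2 * \<Upsilon> * A - q"
    using phi_relations[OF k] by (auto simp: A_def A'_def B_def B'_def r_def p)
  have "\<Upsilon> * (s * A') * (1 + \<sigma>) = (s * A') * (P * r)"
    using phi_product[of k] k A unfolding p A'_def[symmetric] A_def[symmetric] r_def[symmetric] s_def[symmetric]
    by (simp add: algebra_simps)
  then have "(s * A') * (\<Upsilon> * (1 + \<sigma>)) = (s * A') * (P * r)" by (simp add: mult_ac)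
  then have Pr: "P * r = \<Upsilon> * (1 + \<sigma>)" using s A' by simp
  have r2i: "r\<^sup>2 * i = 2 * A - q * i" unfolding r2 using i by algebra
  have q_s: "q = 1 - s" by (simp add: s_def)
  have Pri: "P * r * i = 1 + \<sigma>" unfolding Pr using i by algebra
  have B'T: "B' * (r * i) = s * A' - A + q * i"
  proof -
    have "B' * (r * i) = A' * s * (P * r * i) - r\<^sup>2 * i" unfolding B' by algebra
    then show ?thesis unfolding Pri r2i using A by algebra
  qed
  \<comment> \<open>The coefficients are compared one by one, each fact being named after its pair of vectors.\<close>
  have ue: "q * (2 * A' - i) * P + B' * \<sigma> = B - q * A * P + 2 * q * A' * P"
  proof -
    have "P * (r\<^sup>2 * i) = r * (P * r * i)" by algebra
    then have "P * (2 * A - q * i) = r * (1 + \<sigma>)" unfolding Pri r2i .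
    then show ?thesis unfolding B B' using A q_s by algebra
  qed
  have gg: "q * (A' - i / 2) + B' * (r * i) + (r\<^sup>2 * i) / 2 = A'"
    unfolding B'T r2i q_s by (simp add: field_simps)
  have ug: "- (q * (2 * A' - i)) - B' * (r * i) = A - (1 + q) * A'"
    unfolding B'T q_s by (simp add: algebra_simps)
  have eg: "- (q * (2 * A' - i)) * P - (B' * (r * i)) * P - B' * \<sigma> - \<sigma> * r = - (1 + q) * A' * P"
    unfolding B'T unfolding B' using A q_s by algebra
  have ee: "q * (A' - i / 2) * P\<^sup>2 + B' * \<sigma> * P + \<Upsilon> / 2 * \<sigma>\<^sup>2 = \<Upsilon> / 2 + q * A' * P\<^sup>2"
  proof -
    have "(r\<^sup>2 * i) * P\<^sup>2 = (P * r * i) * (P * r)" by algebra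
    then have "(2 * A - q * i) * P\<^sup>2 = \<Upsilon> * (1 + \<sigma>)\<^sup>2"
      unfolding r2i Pri Pr using i by algebra
    moreover have "B' * \<sigma> * P = A * P\<^sup>2 - \<sigma> * (P * r)" unfolding B' A by algebra
    ultimately show ?thesis unfolding Pr by algebra
  qed
  have x: "x = 1 *\<^sub>R u + P *\<^sub>R e + 0 *\<^sub>R g" by (simp add: x_def P_def s_def)
  have v: "x - g = 1 *\<^sub>R u + P *\<^sub>R e + (-1) *\<^sub>R g" by (simp add: x)
  have w: "g - q *\<^sub>R x = (- q) *\<^sub>R u + (- q * P) *\<^sub>R e + 1 *\<^sub>R g"
    by (simp add: x scaleR_add_right)
  have e': "(a k / ((1 - q) * a (k + 1))) *\<^sub>R e - (\<phi> k / \<Upsilon>) *\<^sub>R g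
      = 0 *\<^sub>R u + \<sigma> *\<^sub>R e + (- (r * i)) *\<^sub>R g"
    by (simp add: defs)
  have "potential (k + 1) (x - g) ((a k / ((1 - q) * a (k + 1))) *\<^sub>R e - (\<phi> k / \<Upsilon>) *\<^sub>R g)
      = q * (A' - i / 2) * ((x - g) \<bullet> (x - g))
        + B' * ((x - g) \<bullet> (0 *\<^sub>R u + \<sigma> *\<^sub>R e + (- (r * i)) *\<^sub>R g))
        + \<Upsilon> / 2 * ((0 *\<^sub>R u + \<sigma> *\<^sub>R e + (- (r * i)) *\<^sub>R g) \<bullet> (0 *\<^sub>R u + \<sigma> *\<^sub>R e + (- (r * i)) *\<^sub>R g))"
    unfolding potential_def e' power2_norm_eq_inner by (simp add: A'_def B'_def i_def)
  also have "\<dots> = q * (A' - i / 2) * (u \<bullet> u)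
      + (q * (A' - i / 2) * P\<^sup>2 + B' * \<sigma> * P + \<Upsilon> / 2 * \<sigma>\<^sup>2) * (e \<bullet> e)
      + (q * (A' - i / 2) + B' * (r * i) + (r\<^sup>2 * i) / 2 * (\<Upsilon> * i)) * (g \<bullet> g)
      + (q * (2 * A' - i) * P + B' * \<sigma>) * (u \<bullet> e)
      + (- (q * (2 * A' - i)) - B' * (r * i)) * (u \<bullet> g)
      + (- (q * (2 * A' - i)) * P - (B' * (r * i)) * P - B' * \<sigma> - \<sigma> * r * (\<Upsilon> * i)) * (e \<bullet> g)"
    unfolding v inner_lincomb3 by algebra
  also have "\<dots> = q * (A' - i / 2) * (u \<bullet> u)
      + (\<Upsilon> / 2 + q * A' * P\<^sup>2) * (e \<bullet> e) + A' * (g \<bullet> g)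
      + (B - q * A * P + 2 * q * A' * P) * (u \<bullet> e)
      + (A - (1 + q) * A') * (u \<bullet> g) + (- (1 + q) * A' * P) * (e \<bullet> g)"
    unfolding i mult_1_right ee gg ue ug eg ..
  also have "\<dots> = (q * (A - i / 2) * (u \<bullet> u) + B * (u \<bullet> e) + \<Upsilon> / 2 * (e \<bullet> e))
      + A * ((g - q *\<^sub>R x) \<bullet> (1 *\<^sub>R u + 0 *\<^sub>R e + 0 *\<^sub>R g)) - A' * ((g - q *\<^sub>R x) \<bullet> (x - g))"
    unfolding v w inner_lincomb3 by algebra
  also have "\<dots> = potential k u e + a k * ((g - q *\<^sub>R x) \<bullet> u) - a (k + 1) * ((g - q *\<^sub>R x) \<bullet> (x - g))"
    unfolding potential_def power2_norm_eq_inner by (simp add: A_def A'_def B_def i_def)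
  finally show ?thesis .
qed

text \<open>At the last step everything that remains beyond the function value is a single square. Dropping
it yields the bound.\<close>

lemma potential_last:
  fixes u e g :: "'v::real_inner"
  defines "x \<equiv> u + (\<phi> 0 / (1 - q)) *\<^sub>R e"
  shows "potential N u e + a N * ((g - q *\<^sub>R x) \<bullet> u) - \<Upsilon> * ((g - q *\<^sub>R x) \<bullet> (x - g))
    = \<Upsilon> / 2 * (q * (1 - q) * (norm x)\<^sup>2 + (norm (g - q *\<^sub>R x))\<^sup>2)
      + \<Upsilon> / 2 * (norm (x - g - (a N / \<Upsilon>) *\<^sub>R u))\<^sup>2"
proof -
  define s i where "s = sqrt (1 - q)" and "i = 1 / \<Upsilon>"
  have s: "s\<^sup>2 = 1 - q" "s \<noteq> 0" using q by (auto simp: s_def)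
  have i: "\<Upsilon> * i = 1" using Upsilon_gt_1 by (simp add: i_def)
  define A C D where "A = a N" and "C = sqrt q * R" and "D = A * i"
  have A: "A = \<Upsilon> - C" by (simp add: A_def C_def a_N)
  have A2: "A\<^sup>2 * i = \<Upsilon> - 2 * C + q * \<Upsilon> - q * i"
  proof -
    have "C\<^sup>2 = q * (\<Upsilon>\<^sup>2 - 1)" using q by (simp add: C_def power_mult_distrib R_square)
    then show ?thesis unfolding A using i by algebra
  qed
  have B: "sqrt q * b N = s * C" by (simp add: b_N s_def C_def)
  have "x - u = (s / s\<^sup>2) *\<^sub>R e" by (simp add: x_def phi_0 s_def[symmetric] s)
  then have e: "e = s *\<^sub>R (x - u)" using s(2) by (simp add: power2_eq_square)
  have "potential N u e = q * (A - i / 2) * (u \<bullet> u) + s * C * (u \<bullet> e) + \<Upsilon> / 2 * (e \<bullet> e)"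
    unfolding potential_def power2_norm_eq_inner B by (simp add: A_def i_def)
  also have "\<dots> = q * (A - i / 2) * (u \<bullet> u) + s\<^sup>2 * C * (u \<bullet> x - u \<bullet> u)
      + \<Upsilon> / 2 * s\<^sup>2 * (x \<bullet> x - 2 * (u \<bullet> x) + u \<bullet> u)"
    unfolding e by (simp add: inner_diff_left inner_diff_right inner_commute power2_eq_square algebra_simps)
  finally have pot: "potential N u e = q * (A - i / 2) * (u \<bullet> u) + (1 - q) * C * (u \<bullet> x - u \<bullet> u)
      + \<Upsilon> / 2 * (1 - q) * (x \<bullet> x - 2 * (u \<bullet> x) + u \<bullet> u)"
    unfolding s .
  have aD: "a N / \<Upsilon> = D" by (simp add: D_def A_def i_def)
  have wu: "(g - q *\<^sub>R x) \<bullet> u = u \<bullet> g - q * (u \<bullet> x)"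
    and wv: "(g - q *\<^sub>R x) \<bullet> (x - g) = x \<bullet> g - g \<bullet> g - q * (x \<bullet> x) + q * (x \<bullet> g)"
    and ww: "(norm (g - q *\<^sub>R x))\<^sup>2 = g \<bullet> g - 2 * q * (x \<bullet> g) + q\<^sup>2 * (x \<bullet> x)"
    and vv: "(norm (x - g - (a N / \<Upsilon>) *\<^sub>R u))\<^sup>2
      = x \<bullet> x - 2 * (x \<bullet> g) + g \<bullet> g - 2 * D * (u \<bullet> x - u \<bullet> g) + D\<^sup>2 * (u \<bullet> u)"
    unfolding aD power2_norm_eq_inner
    by (simp_all add: inner_diff_left inner_diff_right inner_commute algebra_simps power2_eq_square)
  have Ai: "\<Upsilon> / 2 * (2 * D) = A" "\<Upsilon> / 2 * D\<^sup>2 = A\<^sup>2 * i / 2"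
    using i unfolding D_def by algebra+
  have vv2: "\<Upsilon> / 2 * (norm (x - g - (a N / \<Upsilon>) *\<^sub>R u))\<^sup>2
      = \<Upsilon> / 2 * (x \<bullet> x - 2 * (x \<bullet> g) + g \<bullet> g) - A * (u \<bullet> x - u \<bullet> g) + A\<^sup>2 * i / 2 * (u \<bullet> u)"
  proof -
    have "\<Upsilon> / 2 * (x \<bullet> x - 2 * (x \<bullet> g) + g \<bullet> g - 2 * D * (u \<bullet> x - u \<bullet> g) + D\<^sup>2 * (u \<bullet> u))
        = \<Upsilon> / 2 * (x \<bullet> x - 2 * (x \<bullet> g) + g \<bullet> g) - (\<Upsilon> / 2 * (2 * D)) * (u \<bullet> x - u \<bullet> g)
          + (\<Upsilon> / 2 * D\<^sup>2) * (u \<bullet> u)" by algebra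
    then show ?thesis unfolding vv Ai .
  qed
  show ?thesis
    unfolding pot wu wv ww vv2 A2 power2_norm_eq_inner[of x] unfolding A_def[symmetric] A
    by (simp add: field_simps power2_eq_square)
qed

end

section \<open>Convergence of the method\<close>

context item_f_constants
begin

text \<open>The displacement that a step adds to the gradient step, scaled so that its recursion contains \<open>\<phi>\<close> only
through \<open>\<phi>\<^sub>k\<close>.\<close>

fun momentum :: "(nat \<Rightarrow> 'v::real_vector) \<Rightarrow> nat \<Rightarrow> 'v" where
  "momentum g 0 = 0"
| "momentum g (Suc k) = (a k / ((1 - q) * a (k + 1))) *\<^sub>R momentum g k - (\<phi> k / \<Upsilon>) *\<^sub>R g k"

text \<open>Let \<open>\<psi>\<^sub>k\<close> be the reduced function value at iterate \<open>k\<close>. The inequality between consecutive iterates with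
weight \<open>a\<^sub>k\<close>, and that between the minimizer and iterate \<open>k\<close> with weight \<open>a\<^sub>k\<^sub>+\<^sub>1 - a\<^sub>k\<close>, raise the coefficient
of the reduced value from \<open>a\<^sub>k\<close> to \<open>a\<^sub>k\<^sub>+\<^sub>1\<close>. So \<open>(1 - q) a\<^sub>k\<^sub>+\<^sub>1 \<psi>\<^sub>k\<close> plus the quadratic part of the potential never
increases. The coefficients run from \<open>a\<^sub>0 = 1/\<Upsilon>\<close> to \<open>a\<^sub>N\<^sub>+\<^sub>1 = \<Upsilon>\<close>, whence the factor \<open>1/\<Upsilon>\<^sup>2\<close>.\<close>

lemma final_value_bound:
  fixes x g :: "nat \<Rightarrow> 'v::real_inner" and F :: "nat \<Rightarrow> real"
  defines "v \<equiv> \<lambda>k. x k - g k" and "w \<equiv> \<lambda>k. g k - q *\<^sub>R x k"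
  defines "\<psi> \<equiv> \<lambda>k. F k - (q * (1 - q) * (norm (x k))\<^sup>2 + (norm (w k))\<^sup>2) / (2 * (1 - q))"
  assumes step: "\<And>k. k < N \<Longrightarrow> x (k + 1) = v k + (\<phi> (N - k - 1) / (1 - q)) *\<^sub>R momentum g (k + 1)"
    and consecutive: "\<And>k. k < N \<Longrightarrow> w (k + 1) \<bullet> (v k - v (k + 1)) \<le> (1 - q) * (\<psi> k - \<psi> (k + 1))"
    and minimizer: "\<And>k. k \<le> N \<Longrightarrow> (1 - q) * \<psi> k \<le> w k \<bullet> v k"
  shows "F N \<le> F 0 / \<Upsilon>\<^sup>2"
proof -
  define E where "E k = (q * (1 - q) * (norm (x k))\<^sup>2 + (norm (w k))\<^sup>2) / 2" for k
  have F: "(1 - q) * F k = (1 - q) * \<psi> k + E k" for k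
    using q by (simp add: \<psi>_def E_def field_simps)
  have combine: "(1 - q) * a (k + 1) * \<psi> k + a k * (w k \<bullet> u) - a (k + 1) * (w k \<bullet> v k)
      \<le> (1 - q) * a k * \<psi> k + a k * (w k \<bullet> u - w k \<bullet> v k)" if "k \<le> N" for k u
  proof -
    have "(a (k + 1) - a k) * ((1 - q) * \<psi> k) \<le> (a (k + 1) - a k) * (w k \<bullet> v k)"
      using minimizer[OF that] a_less_Suc[OF that] by (intro mult_left_mono) auto
    then show ?thesis by (simp add: algebra_simps)
  qed
  have absorb: "(1 - q) * a (k + 2) * \<psi> (k + 1)
        + a (k + 1) * (w (k + 1) \<bullet> v k) - a (k + 2) * (w (k + 1) \<bullet> v (k + 1))
      \<le> (1 - q) * a (k + 1) * \<psi> k" if "k < N" for k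
  proof -
    have "a (k + 1) * (w (k + 1) \<bullet> (v k - v (k + 1))) \<le> a (k + 1) * ((1 - q) * (\<psi> k - \<psi> (k + 1)))"
      using consecutive[OF that] a_pos[of "k + 1"] that by (intro mult_left_mono) auto
    then show ?thesis
      using combine[of "k + 1" "v k"] that by (simp add: inner_diff_right algebra_simps)
  qed
  have invariant: "(1 - q) * a (k + 1) * \<psi> k + potential (k + 1) (v k) (momentum g (k + 1))
      \<le> (1 - q) * F 0 / \<Upsilon>" if "k < N" for k
    using that
  proof (induction k)
    case 0
    have "potential 1 (v 0) (momentum g 1) = E 0 / \<Upsilon> - (a 1 - a 0) * (w 0 \<bullet> v 0)"
      using potential_first[of "x 0" "g 0"] by (simp add: v_def w_def E_def)
    moreover have "(1 - q) * a 1 * \<psi> 0 - (a 1 - a 0) * (w 0 \<bullet> v 0) \<le> (1 - q) * a 0 * \<psi> 0"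
      using combine[of 0 "v 0"] by (simp add: algebra_simps)
    moreover have "(1 - q) * F 0 / \<Upsilon> = (1 - q) * a 0 * \<psi> 0 + E 0 / \<Upsilon>"
      unfolding F a_0 by (simp add: add_divide_distrib)
    ultimately show ?case by simp
  next
    case (Suc k)
    have x: "x (k + 1) = v k + (\<phi> (N - (k + 1)) / (1 - q)) *\<^sub>R momentum g (k + 1)"
      using step[of k] Suc by simp
    have "potential (k + 2) (v (k + 1)) (momentum g (k + 2))
        = potential (k + 1) (v k) (momentum g (k + 1))
          + a (k + 1) * (w (k + 1) \<bullet> v k) - a (k + 2) * (w (k + 1) \<bullet> v (k + 1))"
      using potential_Suc[of "k + 1" "v k" "momentum g (k + 1)" "g (k + 1)", folded x] Suc.prems
      by (simp add: v_def w_def)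
    then show ?case using absorb[of k] Suc by simp
  qed
  have N1: "N - 1 < N" "N - 1 + 1 = N" using N by auto
  have "x N = v (N - 1) + (\<phi> 0 / (1 - q)) *\<^sub>R momentum g N"
    using step[OF N1(1)] N1(2) by simp
  from potential_last[of "v (N - 1)" "momentum g N" "g N", folded this]
  have "\<Upsilon> * E N \<le> potential N (v (N - 1)) (momentum g N)
      + a N * (w N \<bullet> v (N - 1)) - \<Upsilon> * (w N \<bullet> v N)"
    using Upsilon_gt_1 by (simp add: v_def w_def E_def)
  moreover have "(1 - q) * a N * \<psi> (N - 1) + potential N (v (N - 1)) (momentum g N) \<le> (1 - q) * F 0 / \<Upsilon>"
    using invariant[OF N1(1)] unfolding N1(2) .
  moreover have "(1 - q) * \<Upsilon> * \<psi> N + a N * (w N \<bullet> v (N - 1)) - \<Upsilon> * (w N \<bullet> v N)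
      \<le> (1 - q) * a N * \<psi> (N - 1)"
  proof -
    have "N - 1 + 2 = N + 1" using N by simp
    then show ?thesis using absorb[OF N1(1)] unfolding N1(2) by (simp add: a_last[simplified])
  qed
  ultimately have "\<Upsilon> * ((1 - q) * \<psi> N + E N) \<le> (1 - q) * F 0 / \<Upsilon>"
    by (simp add: algebra_simps)
  then have "(1 - q) * (\<Upsilon> * F N) \<le> (1 - q) * (F 0 / \<Upsilon>)"
    unfolding F[symmetric] by (simp add: mult_ac)
  moreover have "0 < 1 - q" using q by simp
  ultimately have "\<Upsilon> * F N \<le> F 0 / \<Upsilon>" by (simp only: mult_le_cancel_left_pos)
  then show ?thesis using Upsilon_gt_1 by (simp add: field_simps power2_eq_square)
qed

text \<open>The coefficient of the gradient in a step of the method is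
\<open>\<phi>\<^sub>N\<^sub>-\<^sub>k\<^sub>-\<^sub>1 (a\<^sub>k + (1 - q) a\<^sub>k\<^sub>+\<^sub>1) / ((1 - q) a\<^sub>k\<^sub>+\<^sub>1 \<phi>\<^sub>N\<^sub>-\<^sub>k)\<close>, which the product identity for \<open>\<phi>\<close> simplifies to
\<open>\<phi>\<^sub>N\<^sub>-\<^sub>k\<^sub>-\<^sub>1 \<phi>\<^sub>k / ((1 - q) \<Upsilon>)\<close>. In the first step the convention for the gradient step with index \<open>-1\<close>
corresponds to momentum zero.\<close>

lemma ITEM_f_momentum_form:
  fixes L :: real and f :: "'v::real_inner \<Rightarrow> real" and x0 :: 'v
  defines "x \<equiv> ITEM_f N L q \<Upsilon> a f x0"
  assumes "k < N"
  shows "x (k + 1) = grad_step L f (x k)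
    + (\<phi> (N - k - 1) / (1 - q)) *\<^sub>R momentum (\<lambda>j. (1 / L) *\<^sub>R grad f (x j)) (k + 1)"
  using \<open>k < N\<close>
proof (induction k)
  case 0
  define g where "g = (1 / L) *\<^sub>R grad f (x 0)"
  define p where "p = \<phi> (N - 1)"
  have "a 0 * p / ((1 - q) * a 1 * \<phi> N) + p / \<phi> N = p * (a 0 + (1 - q) * a 1) / ((1 - q) * a 1 * \<phi> N)"
    using q a_pos[of 1] phi_pos[of N] by (simp add: field_simps)
  also have "a 0 + (1 - q) * a 1 = a 1 * \<phi> N * \<phi> 0 / \<Upsilon>"
    using phi_product[of 0] N Upsilon_gt_1 by (simp add: field_simps)
  also have "p * (a 1 * \<phi> N * \<phi> 0 / \<Upsilon>) / ((1 - q) * a 1 * \<phi> N) = p / (1 - q) * (\<phi> 0 / \<Upsilon>)"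
    using a_pos[of 1] phi_pos[of N] by simp
  finally have coeff: "a 0 * p / ((1 - q) * a 1 * \<phi> N) + p / \<phi> N = p / (1 - q) * (\<phi> 0 / \<Upsilon>)" .
  have "x 0 = x0" by (simp add: x_def)
  then have "x 1 = grad_step L f (x 0)
      + (a 0 * p / ((1 - q) * a 1 * \<phi> N)) *\<^sub>R (grad_step L f (x 0) - x 0)
      + (p / \<phi> N) *\<^sub>R (grad_step L f (x 0) - x 0)"
    by (simp add: x_def Let_def p_def)
  moreover have "grad_step L f (x 0) - x 0 = - g" by (simp add: grad_step_def g_def)
  ultimately have "x 1 = grad_step L f (x 0) - (a 0 * p / ((1 - q) * a 1 * \<phi> N) + p / \<phi> N) *\<^sub>R g"
    by (simp only: scaleR_add_left scaleR_minus_right) simp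
  then show ?case unfolding coeff by (simp add: p_def g_def)
next
  case (Suc k)
  define g where "g = (\<lambda>j. (1 / L) *\<^sub>R grad f (x j))"
  define e where "e = momentum g (k + 1)"
  define p r where "p = \<phi> (N - k - 1)" and "r = \<phi> (N - k - 2)"
  define A where "A = a (k + 1) * r / ((1 - q) * a (k + 2) * p)"
  have p: "0 < p" using phi_pos by (simp add: p_def)
  have a2: "0 < a (k + 2)" "0 < a (k + 1)" using a_pos Suc.prems by auto
  have v: "grad_step L f (x j) = x j - g j" for j by (simp add: grad_step_def g_def)
  have IH: "x (k + 1) = (x k - g k) + (p / (1 - q)) *\<^sub>R e"
    using Suc.IH[folded g_def] Suc.prems by (simp add: p_def e_def v)
  have x2: "x (k + 2) = (x (k + 1) - g (k + 1))
      + A *\<^sub>R ((x (k + 1) - g (k + 1)) - (x k - g k)) + (r / p) *\<^sub>R ((x (k + 1) - g (k + 1)) - x (k + 1))"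
  proof -
    have "x (Suc (Suc k)) = grad_step L f (x (Suc k))
      + A *\<^sub>R (grad_step L f (x (Suc k)) - grad_step L f (x k)) + (r / p) *\<^sub>R (grad_step L f (x (Suc k)) - x (Suc k))"
      unfolding x_def ITEM_f.simps(2)[of N L q \<Upsilon> a f x0 "Suc k"] Let_def
      by (simp add: A_def r_def p_def numeral_2_eq_2)
    then show ?thesis unfolding v by (simp add: numeral_2_eq_2)
  qed
  have prod: "\<Upsilon> * (a (k + 1) + (1 - q) * a (k + 2)) = a (k + 2) * p * \<phi> (k + 1)"
    using phi_product[of "k + 1"] Suc.prems by (simp add: p_def)
  have "A + r / p = r * (a (k + 1) + (1 - q) * a (k + 2)) / ((1 - q) * a (k + 2) * p)"
    using q a2 p by (simp add: A_def field_simps)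
  also have "a (k + 1) + (1 - q) * a (k + 2) = a (k + 2) * p * \<phi> (k + 1) / \<Upsilon>"
    using prod Upsilon_gt_1 by (simp add: field_simps)
  also have "r * (a (k + 2) * p * \<phi> (k + 1) / \<Upsilon>) / ((1 - q) * a (k + 2) * p) = r / (1 - q) * (\<phi> (k + 1) / \<Upsilon>)"
    using a2 p by simp
  finally have coeff_g: "A + r / p = r / (1 - q) * (\<phi> (k + 1) / \<Upsilon>)" .
  have coeff_e: "A * (p / (1 - q)) = r / (1 - q) * (a (k + 1) / ((1 - q) * a (k + 2)))"
    using p by (simp add: A_def mult_ac)
  have diff: "(x (k + 1) - g (k + 1)) - (x k - g k) = (p / (1 - q)) *\<^sub>R e - g (k + 1)"
    unfolding IH by simp
  have "x (k + 2) = (x (k + 1) - g (k + 1)) + (A * (p / (1 - q))) *\<^sub>R e - (A + r / p) *\<^sub>R g (k + 1)"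
    unfolding x2 diff by (simp add: algebra_simps)
  also have "\<dots> = (x (k + 1) - g (k + 1)) + (r / (1 - q)) *\<^sub>R momentum g (k + 2)"
  proof -
    have "momentum g (k + 2) = (a (k + 1) / ((1 - q) * a (k + 2))) *\<^sub>R e - (\<phi> (k + 1) / \<Upsilon>) *\<^sub>R g (k + 1)"
      using momentum.simps(2)[of g "k + 1"] by (simp add: e_def numeral_2_eq_2 del: momentum.simps)
    then show ?thesis unfolding coeff_e coeff_g by (simp only: scaleR_diff_right scaleR_scaleR) simp
  qed
  finally show ?case unfolding g_def[symmetric] by (simp add: v r_def numeral_2_eq_2)
qed

end

theorem theorem3:
  fixes N :: nat and L \<mu> q \<Upsilon> :: real and a b :: "nat \<Rightarrow> real"
    and f :: "real ^ 'd \<Rightarrow> real" and x0 xstar :: "real ^ 'd"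
  assumes "N \<ge> 1"
    and "0 < \<mu>" and "\<mu> < L" and "q = \<mu> / L"
    and "L_smooth L f" and "strongly_convex \<mu> f"
    and "ITEM_f_constants N q \<Upsilon> a b"
    and "xstar = arg_min f (\<lambda>_. True)"
  shows "f (ITEM_f N L q \<Upsilon> a f x0 N) - f xstar \<le> 1 / \<Upsilon>\<^sup>2 * (f x0 - f xstar)
       \<and> 1 / \<Upsilon>\<^sup>2 * (f x0 - f xstar) \<le> 4 * (1 - sqrt q) ^ (2 * N) * (f x0 - f xstar)"
proof -
  have L: "0 < L" using assms by simp
  have q: "0 < q" "q < 1" using assms(2,3,4) L by auto
  interpret item_f_constants N q \<Upsilon> a b
    using assms(1,7) q(1,2) by (intro item_f_constants.intro)
  interpret smooth_strongly_convex L \<mu> f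
    using assms(2,3,5,6) by (intro smooth_strongly_convex.intro)
  have min: "f xstar \<le> f y" for y using arg_min_le assms(8) by simp
  have grad_star: "grad f xstar = 0" by (rule grad_minimizer) (rule min)
  \<comment> \<open>The potential argument runs with the minimizer at the origin and \<open>L = 1\<close>.\<close>
  define X where "X = ITEM_f N L q \<Upsilon> a f x0"
  define x where "x k = X k - xstar" for k
  define g where "g k = (1 / L) *\<^sub>R grad f (X k)" for k
  define F where "F k = (f (X k) - f xstar) / L" for k
  have interp: "(f y' - f xstar) / L + ((1 / L) *\<^sub>R grad f y') \<bullet> ((y - xstar) - (y' - xstar))
        + q / 2 * (norm ((y - xstar) - (y' - xstar)))\<^sup>2
        + (norm ((1 / L) *\<^sub>R grad f y - (1 / L) *\<^sub>R grad f y' - q *\<^sub>R ((y - xstar) - (y' - xstar))))\<^sup>2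
          / (2 * (1 - q)) \<le> (f y - f xstar) / L" for y y'
    using interpolation_normalized[of y' y] unfolding assms(4)[symmetric] by (simp add: diff_divide_distrib)
  have "F N \<le> F 0 / \<Upsilon>\<^sup>2"
  proof (rule final_value_bound[of x g F])
    fix k assume k: "k < N"
    show "x (k + 1) = x k - g k + (\<phi> (N - k - 1) / (1 - q)) *\<^sub>R momentum g (k + 1)"
    proof -
      have "(\<lambda>j. (1 / L) *\<^sub>R grad f (X j)) = g" by (simp add: g_def fun_eq_iff)
      then show ?thesis
        using ITEM_f_momentum_form[OF k, of L f x0, folded X_def]
        by (simp add: x_def grad_step_def g_def[of k] del: momentum.simps)
    qed
    show "(g (k + 1) - q *\<^sub>R x (k + 1)) \<bullet> (x k - g k - (x (k + 1) - g (k + 1)))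
      \<le> (1 - q) * (F k - (q * (1 - q) * (norm (x k))\<^sup>2 + (norm (g k - q *\<^sub>R x k))\<^sup>2) / (2 * (1 - q))
        - (F (k + 1) - (q * (1 - q) * (norm (x (k + 1)))\<^sup>2 + (norm (g (k + 1) - q *\<^sub>R x (k + 1)))\<^sup>2) / (2 * (1 - q))))"
      by (rule interpolation_potential_form[OF q(2)], rule interp[of "X (k + 1)" "X k", folded F_def x_def g_def])
  next
    fix k assume "k \<le> N"
    \<comment> \<open>The minimizer itself, where position, gradient and value all vanish.\<close>
    have "(g k - q *\<^sub>R x k) \<bullet> (0 - 0 - (x k - g k))
      \<le> (1 - q) * (0 - (q * (1 - q) * (norm (0 :: real ^ 'd))\<^sup>2 + (norm (0 - q *\<^sub>R (0 :: real ^ 'd)))\<^sup>2) / (2 * (1 - q))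
        - (F k - (q * (1 - q) * (norm (x k))\<^sup>2 + (norm (g k - q *\<^sub>R x k))\<^sup>2) / (2 * (1 - q))))"
      by (rule interpolation_potential_form[OF q(2)], use interp[of "X k" xstar, folded F_def x_def g_def] in \<open>simp add: grad_star\<close>)
    then show "(1 - q) * (F k - (q * (1 - q) * (norm (x k))\<^sup>2 + (norm (g k - q *\<^sub>R x k))\<^sup>2) / (2 * (1 - q)))
      \<le> (g k - q *\<^sub>R x k) \<bullet> (x k - g k)"
      by (simp add: inner_diff_right right_diff_distrib)
  qed
  then have "L * F N \<le> L * (F 0 / \<Upsilon>\<^sup>2)" using L by (intro mult_left_mono) auto
  moreover have "X 0 = x0" by (simp add: X_def)
  ultimately have "f (X N) - f xstar \<le> 1 / \<Upsilon>\<^sup>2 * (f x0 - f xstar)"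
    using L by (simp add: F_def)
  moreover have "1 / \<Upsilon>\<^sup>2 * (f x0 - f xstar) \<le> 4 * (1 - sqrt q) ^ (2 * N) * (f x0 - f xstar)"
    using inverse_Upsilon_square_le min[of x0] by (intro mult_right_mono) auto
  ultimately show ?thesis unfolding X_def by blast
qed

end
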